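(* Consider quickest detection of an attenuating Gaussian signal with known source location, as described in the context, with path-loss exponent $\theta>0$. Then $T_{\mathrm{RP}}=\inf\{n\in\mathbb{N}_0:\pi_{n,0}\le\alpha\}$ is first-order asymptotically optimal, i.e. $$\lim_{\alpha\to0}\frac{\inf_{T:\,\mathrm{PFA}(T)\le\alpha}\mathrm{ADD}(T)}{\mathrm{ADD}(T_{\mathrm{RP}})}=1.$$ Moreover, in the free-space case $\theta=2$, $$\mathrm{ADD}(T_{\mathrm{RP}})=\frac{|\log\alpha|}{L\,q_\phi+|\log(1-\rho)|}\,(1+o(1)),$$ with $o(1)\to0$ as $\alpha\to0$, where $$q_\phi=\frac{1}{2R^2}\Big[\phi+\phi\log(\phi+1)-(\phi+R^2)\log\Big(1+\frac{\phi}{R^2}\Big)\Big],\qquad \phi=\frac{\gamma^2}{\sigma^2}.$$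
   Context: Notation: $\mathbb{N}_0=\{0,1,2,\dots\}$, $\mathbb{N}=\{1,2,\dots\}$, $x^+=\max\{0,x\}$; $\mathcal{N}(\mu,v)$ is the Gaussian law with mean $\mu$ and variance $v$. Setting. The domain is a disk in $\mathbb{R}^2$ of (large) radius $R\ge1$ centered at a signal source whose location $o$ is known. The change point $t$ is geometric with parameter $\rho\in(0,1)$: $\mathbb{P}(t=m)=\rho(1-\rho)^m$, $m\in\mathbb{N}_0$. The event propagates deterministically at constant velocity: its integer radius (in some fixed distance unit) is $0$ at times $n<t$, and $\min(n-t+1,\mathfrak{R})$ at times $n\ge t$, where $\mathfrak{R}\in\mathbb{N}$ is a finite number of units sufficient to cover the whole disk. At each time $n\in\mathbb{N}$ there are $L\ge1$ sensors, located independently and uniformly at random within the disk (independently over time and of $t$). The locations are known to the fusion center. Observations. Conditionally on $t$ and on the sensor locations, all observations are independent. A sensor at distance $d$ from the source observes a sample from $f_1^{(d)}=\mathcal{N}(0,\sigma^2+\gamma^2/\tilde d^{\,\theta})$, $\tilde d=\max(d,1)$, if it lies strictly within the current radius of the event, and a sample from $f_0=\mathcal{N}(0,\sigma^2)$ otherwise. Here $\sigma^2>0$ is the noise variance and $\gamma^2>0$ the signal transmit power. Performance. $I_n$ is the information (observations and sensor locations) from times $1,\dots,n$, with $I_0$ empty. Stopping times $T$ are with respect to the filtration generated by $(I_n)$. The posterior no-change probability is $\pi_{n,0}=\mathbb{P}(t>n\mid I_n)$, and $\mathrm{ADD}(T)=\mathbb{E}[(T-t)^+]$, $\mathrm{PFA}(T)=\mathbb{P}(T<t)$,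 with $\alpha\in(0,1)$. *)

theory Defs
  imports "HOL-Probability.Probability"
begin

definition gaussian :: "real \<Rightarrow> real \<Rightarrow> real measure" where
  "gaussian m v = density lborel (\<lambda>x. ennreal (normal_density m (sqrt v) x))"

text \<open>The \<open>L\<close> sensors at each time are indexed by \<open>l < L\<close>; time \<open>0\<close> carries no sensors.\<close>

definition sensors :: "nat \<Rightarrow> (nat \<times> nat) set" where
  "sensors L = {1..} \<times> {..<L}"

text \<open>Radius of the event at time \<open>n\<close>, in distance units, when the change point is \<open>m\<close>.\<close>

definition event_radius :: "nat \<Rightarrow> nat \<Rightarrow> nat \<Rightarrow> nat" where
  "event_radius Rmax m n = (if n < m then 0 else min (n - m + 1) Rmax)"

text \<open>Law of a sample at distance \<open>d\<close> from the source at time \<open>n\<close> when the change point is \<open>m\<close>;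
  \<open>u\<close> is the length of the distance unit.\<close>

definition sample_law ::
  "real \<Rightarrow> nat \<Rightarrow> real \<Rightarrow> real \<Rightarrow> real \<Rightarrow> nat \<Rightarrow> nat \<Rightarrow> real \<Rightarrow> real measure" where
  "sample_law u Rmax \<sigma> \<gamma> \<theta> m n d =
     (if d < u * real (event_radius Rmax m n)
      then gaussian 0 (\<sigma>\<^sup>2 + \<gamma>\<^sup>2 / max d 1 powr \<theta>)
      else gaussian 0 (\<sigma>\<^sup>2))"

definition cprob :: "'a measure \<Rightarrow> 'a measure \<Rightarrow> 'a set \<Rightarrow> 'a \<Rightarrow> real" where
  "cprob M F A = real_cond_exp M F (indicat_real A)"

definition location_info ::
  "'a measure \<Rightarrow> (nat \<Rightarrow> nat \<Rightarrow> 'a \<Rightarrow> real^2) \<Rightarrow> nat \<Rightarrow> 'a measure" where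
  "location_info M X L = sigma (space M)
     {X n l -` B \<inter> space M | n l B. (n, l) \<in> sensors L \<and> B \<in> sets borel}"

text \<open>The sigma-algebra generated by the change point and all sensor locations.\<close>

definition hidden_info ::
  "'a measure \<Rightarrow> ('a \<Rightarrow> nat) \<Rightarrow> (nat \<Rightarrow> nat \<Rightarrow> 'a \<Rightarrow> real^2) \<Rightarrow> nat \<Rightarrow> 'a measure" where
  "hidden_info M t X L = sigma (space M)
     ({t -` A \<inter> space M | A. True} \<union>
      {X n l -` B \<inter> space M | n l B. (n, l) \<in> sensors L \<and> B \<in> sets borel})"

locale attenuating_signal_detection = prob_space M
  for M :: "'a measure" +
  fixes t :: "'a \<Rightarrow> nat"
    and X :: "nat \<Rightarrow> nat \<Rightarrow> 'a \<Rightarrow> real^2"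
    and Y :: "nat \<Rightarrow> nat \<Rightarrow> 'a \<Rightarrow> real"
    and src :: "real^2"
    and R u :: real
    and Rmax L :: nat
    and \<rho> \<sigma> \<gamma> \<theta> :: real
  assumes R_ge_1: "R \<ge> 1"
    and unit_pos: "u > 0"
    and Rmax_pos: "Rmax \<ge> 1"
    and Rmax_covers: "R \<le> u * real Rmax"
    and L_pos: "L \<ge> 1"
    and rho: "0 < \<rho>" "\<rho> < 1"
    and noise_var_pos: "\<sigma>\<^sup>2 > 0"
    and power_pos: "\<gamma>\<^sup>2 > 0"
    and theta_pos: "\<theta> > 0"
    and t_measurable: "t \<in> measurable M (count_space UNIV)"
    and t_geometric: "\<And>m. prob {\<omega> \<in> space M. t \<omega> = m} = \<rho> * (1 - \<rho>) ^ m"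
    and X_measurable: "\<And>n l. (n, l) \<in> sensors L \<Longrightarrow> X n l \<in> borel_measurable M"
    and X_uniform: "\<And>n l. (n, l) \<in> sensors L \<Longrightarrow>
      distr M borel (X n l) = uniform_measure lborel (cball src R)"
    and X_indep: "indep_vars (\<lambda>_. borel) (\<lambda>(n, l). X n l) (sensors L)"
    and X_indep_t: "indep_set {t -` A \<inter> space M | A. True} (sets (location_info M X L))"
    and Y_measurable: "\<And>n l. (n, l) \<in> sensors L \<Longrightarrow> Y n l \<in> borel_measurable M"
    and Y_cond_law: "\<And>n l B. (n, l) \<in> sensors L \<Longrightarrow> B \<in> sets borel \<Longrightarrow>
      AE \<omega> in M. cprob M (hidden_info M t X L) {\<omega> \<in> space M. Y n l \<omega> \<in> B} \<omega> =
        measure (sample_law u Rmax \<sigma> \<gamma> \<theta> (t \<omega>) n (dist (X n l \<omega>) src)) B"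
    and Y_cond_indep: "\<And>J B. finite J \<Longrightarrow> J \<subseteq> sensors L \<Longrightarrow>
      (\<And>n l. (n, l) \<in> J \<Longrightarrow> B n l \<in> sets borel) \<Longrightarrow>
      AE \<omega> in M.
        cprob M (hidden_info M t X L) {\<omega> \<in> space M. \<forall>(n, l)\<in>J. Y n l \<omega> \<in> B n l} \<omega> =
        (\<Prod>(n, l)\<in>J. cprob M (hidden_info M t X L) {\<omega> \<in> space M. Y n l \<omega> \<in> B n l} \<omega>)"

text \<open>The sigma-algebra of \<open>I\<^sub>n\<close>. The index is extended to \<open>\<infinity>\<close>, where it is generated by
  all observations and locations, so that \<^const>\<open>stopping_time\<close> applies to possibly infinite
  times; the condition it adds at \<open>\<infinity>\<close> is void.\<close>

definition info ::
  "'a measure \<Rightarrow> (nat \<Rightarrow> nat \<Rightarrow> 'a \<Rightarrow> real^2) \<Rightarrow> (nat \<Rightarrow> nat \<Rightarrow> 'a \<Rightarrow> real) \<Rightarrow> nat \<Rightarrow>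
    enat \<Rightarrow> 'a measure" where
  "info M X Y L n = sigma (space M)
     ({X k l -` B \<inter> space M | k l B. (k, l) \<in> sensors L \<and> enat k \<le> n \<and> B \<in> sets borel} \<union>
      {Y k l -` B \<inter> space M | k l B. (k, l) \<in> sensors L \<and> enat k \<le> n \<and> B \<in> sets borel})"

definition no_change_posterior ::
  "'a measure \<Rightarrow> ('a \<Rightarrow> nat) \<Rightarrow> (nat \<Rightarrow> nat \<Rightarrow> 'a \<Rightarrow> real^2) \<Rightarrow> (nat \<Rightarrow> nat \<Rightarrow> 'a \<Rightarrow> real) \<Rightarrow>
    nat \<Rightarrow> nat \<Rightarrow> 'a \<Rightarrow> real" where
  "no_change_posterior M t X Y L n = cprob M (info M X Y L (enat n)) {\<omega> \<in> space M. t \<omega> > n}"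

text \<open>The infimum of the empty set in \<^typ>\<open>enat\<close> is \<open>\<infinity>\<close>.\<close>

definition T_RP ::
  "'a measure \<Rightarrow> ('a \<Rightarrow> nat) \<Rightarrow> (nat \<Rightarrow> nat \<Rightarrow> 'a \<Rightarrow> real^2) \<Rightarrow> (nat \<Rightarrow> nat \<Rightarrow> 'a \<Rightarrow> real) \<Rightarrow>
    nat \<Rightarrow> real \<Rightarrow> 'a \<Rightarrow> enat" where
  "T_RP M t X Y L \<alpha> \<omega> = Inf {enat n | n. no_change_posterior M t X Y L n \<omega> \<le> \<alpha>}"

text \<open>Subtraction on \<^typ>\<open>enat\<close> is truncated at \<open>0\<close>, hence it is the positive part.\<close>

definition ADD :: "'a measure \<Rightarrow> ('a \<Rightarrow> nat) \<Rightarrow> ('a \<Rightarrow> enat) \<Rightarrow> ennreal" where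
  "ADD M t T = (\<integral>\<^sup>+ \<omega>. ennreal_of_enat (T \<omega> - enat (t \<omega>)) \<partial>M)"

definition PFA :: "'a measure \<Rightarrow> ('a \<Rightarrow> nat) \<Rightarrow> ('a \<Rightarrow> enat) \<Rightarrow> real" where
  "PFA M t T = measure M {\<omega> \<in> space M. T \<omega> < enat (t \<omega>)}"

definition q_free_space :: "real \<Rightarrow> real \<Rightarrow> real" where
  "q_free_space R \<phi> = 1 / (2 * R\<^sup>2) *
     (\<phi> + \<phi> * ln (\<phi> + 1) - (\<phi> + R\<^sup>2) * ln (1 + \<phi> / R\<^sup>2))"

end

theory Submission
  imports Defs
begin

text \<open>
  Both claims follow from \<open>ADD (T_RP \<alpha>) \<sim> \<bar>ln \<alpha>\<bar> / D\<close> together with the matching lower bound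
  for every stopping time of false alarm probability at most \<open>\<alpha>\<close>. The rate is
  \<open>D = L \<cdot> q + \<bar>ln (1 - \<rho>)\<bar>\<close>: once the event covers the disk, each of the \<open>L\<close> samples adds on average
  the Kullback-Leibler divergence \<open>q\<close>, averaged over the uniform location, to the log-likelihood ratio
  of ``change at \<open>k\<close>'' against ``no change yet'', and the geometric prior adds \<open>\<bar>ln (1 - \<rho>)\<bar>\<close> per time
  step.

  The probabilistic input is that, given the change point, the pairs of location and sample are
  independent with explicit densities (\<open>measure_given_rectangle\<close>, \<open>indep_obs_given_change\<close>). Hence the
  law of the first \<open>n\<close> observations given a change at \<open>k\<close> has density \<open>LR k n\<close> with respect to their law
  given that no change has occurred (\<open>change_of_measure\<close>), and the moments of \<open>LR k n\<close> factorize. A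
  single factor has an explicit Gaussian integral, and small exponents \<open>s\<close> of either sign give
  \<open>E\<^sub>k [LR k (k + j) powr s] \<le> const \<cdot> exp (L (j + 1) (s q + O(s\<^sup>2)))\<close> (\<open>LR_moment_bound\<close>). The steps
  during which the event still grows are finitely many and only affect the constant. Chernoff bounds
  derived from this replace all laws of large numbers.

  Upper bound (\<open>ADD_T_post_le\<close>): almost surely the posterior no-change probability is at most
  \<open>P (t > n) / (P (t = k) LR k n)\<close>, so a late alarm forces \<open>LR k (k + j)\<close> to be small although it
  typically grows like \<open>exp (j L q)\<close>. The Chernoff bound with \<open>s < 0\<close> is summable in \<open>j\<close> beyond
  \<open>\<bar>ln \<alpha>\<bar> / D\<close>, uniformly in \<open>k\<close>.

  Lower bound (\<open>ADD_ge\<close>): the event \<open>T \<le> k + K\<close> is known at time \<open>k + K\<close>. Jointly with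
  \<open>t > k + K\<close> it is a false alarm, so its probability given no change is at most
  \<open>\<alpha> / (1 - \<rho>) ^ (k + K + 1)\<close>; a change at \<open>k\<close> multiplies probabilities by at most
  \<open>exp c\<close> except where \<open>LR k (k + K) > exp c\<close>, which the Chernoff bound with \<open>s > 0\<close> makes unlikely for \<open>c\<close> slightly above \<open>K L q\<close>. So with \<open>K\<close> slightly below \<open>\<bar>ln \<alpha>\<bar> / D\<close>, no admissible
  stopping time stops within \<open>K\<close> steps of the change with appreciable probability.

  For path-loss exponent 2 the divergence is an elementary function of the squared distance, which is
  uniform on \<open>[0, R\<^sup>2]\<close>, so its mean \<open>q\<close> can be integrated in closed form (\<open>kl_rate_free_space\<close>).
\<close>

section \<open>Gaussian likelihood ratios\<close>

text \<open>The logarithm of the moment of order \<open>s\<close> of the likelihood ratio of \<open>N(0, a r)\<close> to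
  \<open>N(0, a)\<close> under \<open>N(0, a r)\<close>; its derivative at \<open>s = 0\<close> is the divergence \<open>gauss_kl r\<close>.\<close>

definition half_tilt :: "real \<Rightarrow> real \<Rightarrow> real" where
  "half_tilt s r = (- s * ln r - ln (1 - s * (r - 1))) / 2"

text \<open>The Kullback-Leibler divergence of \<open>N(0, a r)\<close> from \<open>N(0, a)\<close>, for every \<open>a > 0\<close>.\<close>

definition gauss_kl :: "real \<Rightarrow> real" where
  "gauss_kl r = (r - 1 - ln r) / 2"

lemma normal_density_zero_mean:
  "a > 0 \<Longrightarrow> normal_density 0 (sqrt a) y = exp (- y\<^sup>2 / (2 * a) - ln (2 * pi * a) / 2)"
  by (simp add: normal_density_def exp_diff real_sqrt_mult ln_sqrt[symmetric] del: ln_sqrt)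

text \<open>A power of a ratio of centred Gaussian densities times a centred Gaussian density is again a
  multiple of such a density, because the exponents are all multiples of \<open>y\<^sup>2\<close>; the condition on \<open>s\<close>
  keeps the resulting variance positive.\<close>

lemma normal_density_ratio_tilt:
  assumes a: "a > 0" and r: "r > 0" and s: "s * (r - 1) < 1"
  shows "(normal_density 0 (sqrt (a * r)) y / normal_density 0 (sqrt a) y) powr s
      * normal_density 0 (sqrt (a * r)) y
    = exp (half_tilt s r) * normal_density 0 (sqrt (a * r / (1 - s * (r - 1)))) y"
proof -
  define c where "c = 1 - s * (r - 1)"
  have c: "c > 0" using s by (simp add: c_def)
  have ar: "a * r > 0" "a * r / c > 0" using a r c by auto
  have lns: "ln (2 * pi * (a * r)) = ln (2 * pi * a) + ln r"
    "ln (2 * pi * (a * r / c)) = ln (2 * pi * a) + ln r - ln c"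
    using a r c by (auto simp: ln_mult ln_div)
  have sq: "s * (- y\<^sup>2 / (2 * (a * r)) + y\<^sup>2 / (2 * a)) - y\<^sup>2 / (2 * (a * r))
      = - y\<^sup>2 / (2 * (a * r / c))"
    using a r c by (simp add: divide_simps) (simp add: c_def algebra_simps)
  have "(normal_density 0 (sqrt (a * r)) y / normal_density 0 (sqrt a) y) powr s
      * normal_density 0 (sqrt (a * r)) y
    = exp (s * (- y\<^sup>2 / (2 * (a * r)) + y\<^sup>2 / (2 * a)) - y\<^sup>2 / (2 * (a * r))
        + (- s * ln r / 2 - ln (2 * pi * a) / 2 - ln r / 2))"
    unfolding normal_density_zero_mean[OF ar(1)] normal_density_zero_mean[OF a] lns
    by (simp add: exp_diff[symmetric] powr_def exp_add[symmetric] algebra_simps diff_divide_distrib add_divide_distrib)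
  also have "\<dots> = exp (half_tilt s r) * exp (- y\<^sup>2 / (2 * (a * r / c)) - ln (2 * pi * (a * r / c)) / 2)"
    unfolding sq lns exp_add[symmetric] half_tilt_def c_def[symmetric]
    by (rule arg_cong[where f=exp]) (simp add: diff_divide_distrib add_divide_distrib)
  finally show ?thesis
    unfolding normal_density_zero_mean[OF ar(2)[unfolded c_def]] c_def .
qed

lemma nn_integral_normal_density: "a > 0 \<Longrightarrow> (\<integral>\<^sup>+ y. normal_density 0 (sqrt a) y \<partial>lborel) = 1"
  by (subst nn_integral_eq_integral) (auto simp: integrable_normal_density)

lemma nn_integral_likelihood_ratio_powr:
  assumes a: "a > 0" and r: "r > 0" and s: "s * (r - 1) < 1"
  shows "(\<integral>\<^sup>+ y. ennreal ((normal_density 0 (sqrt (a * r)) y / normal_density 0 (sqrt a) y) powr s)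
      * ennreal (normal_density 0 (sqrt (a * r)) y) \<partial>lborel) = exp (half_tilt s r)"
proof -
  have "a * r / (1 - s * (r - 1)) > 0" using a r s by auto
  then show ?thesis
    using nn_integral_normal_density[of "a * r / (1 - s * (r - 1))"]
    by (simp add: ennreal_mult[symmetric] normal_density_ratio_tilt[OF assms])
      (simp add: ennreal_mult nn_integral_cmult)
qed

lemma gauss_kl_bounds:
  assumes "1 \<le> r"
  shows "0 \<le> gauss_kl r" "gauss_kl r \<le> (r - 1) / 2"
  using ln_le_minus_one[of r] ln_ge_zero[of r] assms by (auto simp: gauss_kl_def)

text \<open>The second-order remainder of \<open>ln (1 + z)\<close> at \<open>z = - s (r - 1)\<close>, uniform over the variance ratios
  that occur.\<close>

lemma half_tilt_le:
  assumes r: "1 \<le> r" "r \<le> 1 + \<phi>" and s: "\<bar>s\<bar> * \<phi> \<le> 1 / 2"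
  shows "half_tilt s r \<le> s * gauss_kl r + s\<^sup>2 * \<phi>\<^sup>2"
    and "\<bar>s * gauss_kl r + s\<^sup>2 * \<phi>\<^sup>2\<bar> \<le> \<bar>s\<bar> * \<phi>"
proof -
  define z where "z = - s * (r - 1)"
  have "\<bar>z\<bar> = \<bar>s\<bar> * (r - 1)" using r by (simp add: z_def abs_mult)
  also have "\<dots> \<le> \<bar>s\<bar> * \<phi>" using r by (intro mult_left_mono) auto
  finally have za: "\<bar>z\<bar> \<le> \<bar>s\<bar> * \<phi>" .
  have "\<bar>ln (1 + z) - z\<bar> \<le> 2 * z\<^sup>2"
    by (rule abs_ln_one_plus_x_minus_x_bound) (use za s in linarith)
  then have "- ln (1 + z) \<le> - z + 2 * z\<^sup>2" by linarith
  moreover have "z\<^sup>2 \<le> (\<bar>s\<bar> * \<phi>)\<^sup>2"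
    using za by (metis abs_ge_zero power2_abs power_mono)
  ultimately show "half_tilt s r \<le> s * gauss_kl r + s\<^sup>2 * \<phi>\<^sup>2"
    by (simp add: half_tilt_def gauss_kl_def z_def power_mult_distrib field_simps)
  have "\<bar>s * gauss_kl r\<bar> \<le> \<bar>s\<bar> * (\<phi> / 2)"
    unfolding abs_mult using gauss_kl_bounds[OF r(1)] r by (intro mult_left_mono) auto
  moreover have "s\<^sup>2 * \<phi>\<^sup>2 \<le> \<bar>s\<bar> * \<phi> * (1 / 2)"
  proof -
    have "s\<^sup>2 * \<phi>\<^sup>2 = (\<bar>s\<bar> * \<phi>) * (\<bar>s\<bar> * \<phi>)" by (simp add: power2_eq_square)
    also have "\<dots> \<le> (\<bar>s\<bar> * \<phi>) * (1 / 2)" using s r by (intro mult_left_mono) auto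
    finally show ?thesis .
  qed
  moreover have "0 \<le> s\<^sup>2 * \<phi>\<^sup>2" by simp
  ultimately show "\<bar>s * gauss_kl r + s\<^sup>2 * \<phi>\<^sup>2\<bar> \<le> \<bar>s\<bar> * \<phi>" unfolding abs_le_iff by linarith
qed

text \<open>From \<open>exp x \<le> 1 / (1 - x)\<close>. Being polynomial in \<open>x\<close>, the bound can be averaged over sensor
  locations.\<close>

lemma exp_le_quadratic:
  fixes x :: real
  assumes "x \<le> 1 / 2"
  shows "exp x \<le> 1 + x + 2 * x\<^sup>2"
proof -
  have "1 - x \<le> exp (- x)" using exp_ge_add_one_self[of "- x"] by simp
  then have "exp x \<le> 1 / (1 - x)"
    using assms by (simp add: exp_minus field_simps)
  also have "\<dots> \<le> 1 + x + 2 * x\<^sup>2"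
  proof -
    have "(1 + x + 2 * x\<^sup>2) * (1 - x) = 1 + x\<^sup>2 * (1 - 2 * x)"
      by (simp add: power2_eq_square algebra_simps)
    also have "\<dots> \<ge> 1" using assms by auto
    finally show ?thesis using assms by (simp add: divide_le_eq)
  qed
  finally show ?thesis .
qed

lemma exp_half_tilt_le:
  assumes r: "1 \<le> r" "r \<le> 1 + \<phi>" and s: "\<bar>s\<bar> * \<phi> \<le> 1 / 2"
  shows "exp (half_tilt s r) \<le> 1 + s * gauss_kl r + 3 * \<phi>\<^sup>2 * s\<^sup>2"
    and "exp (half_tilt s r) \<le> exp 1"
proof -
  define x where "x = s * gauss_kl r + s\<^sup>2 * \<phi>\<^sup>2"
  note b = half_tilt_le[OF assms, folded x_def]
  have x: "\<bar>x\<bar> \<le> 1 / 2" using b(2) s by linarith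
  have "x\<^sup>2 \<le> (\<bar>s\<bar> * \<phi>)\<^sup>2" using b(2) by (metis abs_ge_zero power2_abs power_mono)
  then have x2: "x\<^sup>2 \<le> s\<^sup>2 * \<phi>\<^sup>2" by (simp add: power_mult_distrib)
  have "exp (half_tilt s r) \<le> exp x" using b(1) by simp
  also have "exp x \<le> 1 + x + 2 * x\<^sup>2" using x by (intro exp_le_quadratic) auto
  also have "\<dots> \<le> 1 + s * gauss_kl r + 3 * \<phi>\<^sup>2 * s\<^sup>2"
    using x2 unfolding x_def by (simp add: mult.commute)
  finally show "exp (half_tilt s r) \<le> 1 + s * gauss_kl r + 3 * \<phi>\<^sup>2 * s\<^sup>2" .
  show "exp (half_tilt s r) \<le> exp 1" using b(1) x by simp
qed

section \<open>Limits\<close>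

lemma eventually_neg_ln_at_right_0:
  assumes "eventually P at_top"
  shows "\<forall>\<^sub>F \<alpha> in at_right 0. P (- ln \<alpha>) \<and> 0 < \<alpha> \<and> \<alpha> < (1::real)"
proof -
  have "filterlim (\<lambda>\<alpha>::real. - ln \<alpha>) at_top (at_right 0)"
    using ln_at_0 by (simp add: filterlim_uminus_at_bot)
  from filterlim_iff[THEN iffD1, OF this, rule_format, OF assms]
  have "\<forall>\<^sub>F \<alpha> in at_right 0. P (- ln \<alpha>)" .
  moreover have "\<forall>\<^sub>F \<alpha> in at_right 0. 0 < \<alpha> \<and> \<alpha> < (1::real)"
    unfolding eventually_at_right_field by (intro exI[of _ 1]) auto
  ultimately show ?thesis by eventually_elim simp
qed

lemma eventually_at_top_linear_le:
  fixes a b c :: real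
  assumes "a > 0"
  shows "\<forall>\<^sub>F l in at_top. b - a * l \<le> c"
  by (rule eventually_at_top_linorderI[of "(b - c) / a"]) (use assms in \<open>simp add: field_simps\<close>)

lemma tendsto_1_if_eventually_near:
  fixes f :: "'b \<Rightarrow> real"
  assumes "\<And>\<eta>. 0 < \<eta> \<Longrightarrow> \<eta> < 1 \<Longrightarrow> \<forall>\<^sub>F x in F. 1 - \<eta> \<le> f x \<and> f x \<le> 1 + \<eta>"
  shows "(f \<longlongrightarrow> 1) F"
proof (rule tendstoI)
  fix e :: real assume "0 < e"
  define \<eta> where "\<eta> = min (e / 2) (1 / 2)"
  have "0 < \<eta>" "\<eta> < 1" "\<eta> < e" using \<open>0 < e\<close> by (auto simp: \<eta>_def)
  from assms[OF this(1,2)] show "\<forall>\<^sub>F x in F. dist (f x) 1 < e"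
    by eventually_elim (use \<open>\<eta> < e\<close> in \<open>auto simp: dist_real_def abs_if\<close>)
qed

context attenuating_signal_detection
begin

section \<open>Law of a single observation\<close>

definition snr :: real where "snr = \<gamma>\<^sup>2 / \<sigma>\<^sup>2"

text \<open>Observation laws are indexed by the radius of the event, in distance units, instead of by change
  point and time; radius 0 gives the no-change law, and radius \<open>Rmax\<close> the law after the event has
  covered the disk.\<close>

definition variance_ratio :: "nat \<Rightarrow> real^2 \<Rightarrow> real" where
  "variance_ratio r x = (if dist x src < u * real r then 1 + snr / max (dist x src) 1 powr \<theta> else 1)"

definition location_law :: "(real^2) measure" where
  "location_law = uniform_measure lborel (cball src R)"

definition obs_density :: "nat \<Rightarrow> (real^2) \<times> real \<Rightarrow> real" where
  "obs_density r z = normal_density 0 (sqrt (\<sigma>\<^sup>2 * variance_ratio r (fst z))) (snd z)"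

definition obs_law :: "nat \<Rightarrow> ((real^2) \<times> real) measure" where
  "obs_law r = density (location_law \<Otimes>\<^sub>M lborel) (\<lambda>z. ennreal (obs_density r z))"

definition likelihood_ratio :: "nat \<Rightarrow> (real^2) \<times> real \<Rightarrow> real" where
  "likelihood_ratio r z = obs_density r z / obs_density 0 z"

definition obs :: "nat \<times> nat \<Rightarrow> 'a \<Rightarrow> (real^2) \<times> real" where
  "obs j \<omega> = (X (fst j) (snd j) \<omega>, Y (fst j) (snd j) \<omega>)"

lemma snr_pos: "snr > 0"
  using noise_var_pos power_pos by (simp add: snr_def)

lemma variance_ratio_bounds: "1 \<le> variance_ratio r x" "variance_ratio r x \<le> 1 + snr"
proof -
  have "1 \<le> max (dist x src) 1 powr \<theta>"
    using theta_pos by (intro ge_one_powr_ge_zero) auto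
  then show "1 \<le> variance_ratio r x" "variance_ratio r x \<le> 1 + snr"
    using snr_pos by (auto simp: variance_ratio_def field_simps)
qed

lemma variance_ratio_0: "variance_ratio 0 x = 1"
  by (simp add: variance_ratio_def)

lemma measurable_variance_ratio [measurable]: "variance_ratio r \<in> borel_measurable borel"
  unfolding variance_ratio_def [abs_def] by measurable

lemma variance_pos: "0 < \<sigma>\<^sup>2 * variance_ratio r x"
  using noise_var_pos variance_ratio_bounds(1)[of r x] by (intro mult_pos_pos) linarith+

lemma sample_law_eq:
  "sample_law u Rmax \<sigma> \<gamma> \<theta> m n (dist x src)
     = gaussian 0 (\<sigma>\<^sup>2 * variance_ratio (event_radius Rmax m n) x)"
  using noise_var_pos by (simp add: sample_law_def variance_ratio_def snr_def distrib_left)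

lemma sets_location_law [measurable_cong, simp]: "sets location_law = sets borel"
  and space_location_law [simp]: "space location_law = UNIV"
  by (simp_all add: location_law_def)

lemma emeasure_disk: "emeasure lborel (cball src R) \<noteq> 0" "emeasure lborel (cball src R) \<noteq> \<infinity>"
proof -
  have "0 < emeasure lborel (cball src R)"
    using content_cball_pos[of R src] R_ge_1 by (simp add: measure_def enn2real_positive_iff)
  then show "emeasure lborel (cball src R) \<noteq> 0" by simp
  show "emeasure lborel (cball src R) \<noteq> \<infinity>"
    using emeasure_lborel_cball_finite[of src R] by simp
qed

lemma prob_space_location_law: "prob_space location_law"
  unfolding location_law_def by (rule prob_space_uniform_measure) (use emeasure_disk in auto)

lemma measurable_obs_density [measurable]:
  "obs_density r \<in> borel_measurable (borel \<Otimes>\<^sub>M borel)"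
  unfolding obs_density_def [abs_def] normal_density_def by measurable

lemma obs_density_pos: "0 < obs_density r z"
  using variance_pos[of r "fst z"] by (simp add: obs_density_def normal_density_pos)

lemma measurable_likelihood_ratio [measurable]:
  "likelihood_ratio r \<in> borel_measurable (borel \<Otimes>\<^sub>M borel)"
  unfolding likelihood_ratio_def [abs_def] by measurable

lemma likelihood_ratio_pos: "0 < likelihood_ratio r z"
  by (simp add: likelihood_ratio_def obs_density_pos)

lemma sets_obs_law [measurable_cong, simp]: "sets (obs_law r) = sets (borel \<Otimes>\<^sub>M borel)"
  unfolding obs_law_def sets_density by (intro sets_pair_measure_cong) auto

lemma space_obs_law [simp]: "space (obs_law r) = UNIV"
  using sets_eq_imp_space_eq[OF sets_obs_law] by (simp add: space_pair_measure)

lemma nn_integral_obs_law: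
  assumes [measurable]: "h \<in> borel_measurable (borel \<Otimes>\<^sub>M borel)"
  shows "(\<integral>\<^sup>+ z. h z \<partial>obs_law r)
    = (\<integral>\<^sup>+ x. (\<integral>\<^sup>+ y. h (x, y) * ennreal (obs_density r (x, y)) \<partial>lborel) \<partial>location_law)"
proof -
  have "(\<integral>\<^sup>+ z. h z \<partial>obs_law r)
      = (\<integral>\<^sup>+ z. ennreal (obs_density r z) * h z \<partial>(location_law \<Otimes>\<^sub>M lborel))"
    unfolding obs_law_def by (rule nn_integral_density) measurable
  also have "\<dots> = (\<integral>\<^sup>+ x. (\<integral>\<^sup>+ y. ennreal (obs_density r (x, y)) * h (x, y) \<partial>lborel) \<partial>location_law)"
    by (rule lborel.nn_integral_fst[symmetric]) measurable
  finally show ?thesis by (simp add: mult.commute)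
qed

text \<open>All Gaussian densities are positive, so every observation law has a density with respect to the
  no-change law.\<close>

lemma obs_law_eq_density_null: "obs_law r = density (obs_law 0) (\<lambda>z. ennreal (likelihood_ratio r z))"
proof -
  have "obs_law r = density (location_law \<Otimes>\<^sub>M lborel)
     (\<lambda>z. ennreal (obs_density 0 z) * ennreal (likelihood_ratio r z))"
    unfolding obs_law_def
  proof (rule density_cong)
    show "AE z in location_law \<Otimes>\<^sub>M lborel.
        ennreal (obs_density r z) = ennreal (obs_density 0 z) * ennreal (likelihood_ratio r z)"
      using obs_density_pos by (auto simp: likelihood_ratio_def ennreal_mult[symmetric] less_imp_le
          less_imp_neq[THEN not_sym] intro!: AE_I2)
  qed measurable
  also have "\<dots> = density (obs_law 0) (\<lambda>z. ennreal (likelihood_ratio r z))"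
    unfolding obs_law_def by (rule density_density_eq[symmetric]) measurable
  finally show ?thesis .
qed

lemma prob_space_obs_law: "prob_space (obs_law r)"
proof
  have "emeasure (obs_law r) (space (obs_law r)) = (\<integral>\<^sup>+ z. 1 \<partial>obs_law r)" by simp
  also have "\<dots> = (\<integral>\<^sup>+ x. 1 \<partial>location_law)"
    by (subst nn_integral_obs_law)
      (auto simp: obs_density_def nn_integral_normal_density variance_pos)
  also have "\<dots> = 1" by (simp add: prob_space.emeasure_space_1[OF prob_space_location_law] del: space_location_law)
  finally show "emeasure (obs_law r) (space (obs_law r)) = 1" .
qed

lemma emeasure_gaussian:
  "B \<in> sets borel \<Longrightarrow> emeasure (gaussian 0 (\<sigma>\<^sup>2 * variance_ratio r x)) B
     = (\<integral>\<^sup>+ y. indicator B y * ennreal (obs_density r (x, y)) \<partial>lborel)"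
  by (simp add: gaussian_def emeasure_density obs_density_def mult.commute)

lemma prob_space_gaussian: "prob_space (gaussian 0 (\<sigma>\<^sup>2 * variance_ratio r x))"
  unfolding gaussian_def using variance_pos[of r x] by (intro prob_space_normal_density) simp

lemma measurable_measure_gaussian [measurable]:
  assumes [measurable]: "B \<in> sets borel"
  shows "(\<lambda>x. measure (gaussian 0 (\<sigma>\<^sup>2 * variance_ratio r x)) B) \<in> borel_measurable borel"
  unfolding measure_def emeasure_gaussian[OF assms] by measurable

lemma measure_obs_law_Times:
  assumes [measurable]: "C \<in> sets borel" "B \<in> sets borel"
  shows "measure (obs_law r) (C \<times> B)
    = (\<integral> x. indicator C x * measure (gaussian 0 (\<sigma>\<^sup>2 * variance_ratio r x)) B \<partial>location_law)"
proof -
  have "emeasure (obs_law r) (C \<times> B) = (\<integral>\<^sup>+ z. indicator (C \<times> B) z \<partial>obs_law r)"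
    by simp
  also have "\<dots> = (\<integral>\<^sup>+ x. (\<integral>\<^sup>+ y. indicator (C \<times> B) (x, y) * ennreal (obs_density r (x, y)) \<partial>lborel) \<partial>location_law)"
    by (rule nn_integral_obs_law) measurable
  also have "\<dots> = (\<integral>\<^sup>+ x. indicator C x * (\<integral>\<^sup>+ y. indicator B y * ennreal (obs_density r (x, y)) \<partial>lborel) \<partial>location_law)"
    by (intro nn_integral_cong, subst nn_integral_cmult[symmetric])
      (auto intro!: nn_integral_cong simp: indicator_times mult.assoc)
  also have "\<dots> = (\<integral>\<^sup>+ x. ennreal (indicator C x * measure (gaussian 0 (\<sigma>\<^sup>2 * variance_ratio r x)) B) \<partial>location_law)"
    using prob_space.finite_measure[OF prob_space_gaussian]
    by (auto intro!: nn_integral_cong simp: emeasure_gaussian[symmetric] ennreal_mult'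
        finite_measure.emeasure_eq_measure split: split_indicator)
  finally show ?thesis
    by (simp add: measure_def[of "obs_law r"] integral_eq_nn_integral)
qed

lemma measurable_obs [measurable]: "j \<in> sensors L \<Longrightarrow> obs j \<in> M \<rightarrow>\<^sub>M borel \<Otimes>\<^sub>M borel"
  using X_measurable Y_measurable unfolding obs_def[abs_def] by (cases j) auto

lemma measurable_change_point [measurable]: "t \<in> measurable M (count_space UNIV)"
  by (rule t_measurable)

section \<open>Joint law of change point, locations and samples\<close>

lemma space_hidden_info: "space (hidden_info M t X L) = space M"
  unfolding hidden_info_def by (rule space_measure_of) auto

lemma sets_hidden_info: "sets (hidden_info M t X L) = sigma_sets (space M) ({t -` A \<inter> space M | A. True} \<union>
      {X n l -` B \<inter> space M | n l B. (n, l) \<in> sensors L \<and> B \<in> sets borel})"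
  unfolding hidden_info_def by (rule sets_measure_of) auto

lemma subalgebra_hidden: "subalgebra M (hidden_info M t X L)"
  unfolding subalgebra_def space_hidden_info sets_hidden_info
  by (intro conjI refl sets.sigma_sets_subset)
    (auto intro!: measurable_sets[OF t_measurable] measurable_sets[OF X_measurable])

lemma finite_measure_subalgebra_hidden_info: "finite_measure_subalgebra M (hidden_info M t X L)"
  by unfold_locales (rule subalgebra_hidden)

lemma measurable_hidden_info:
  "t \<in> measurable (hidden_info M t X L) (count_space UNIV)"
  "(n, l) \<in> sensors L \<Longrightarrow> X n l \<in> borel_measurable (hidden_info M t X L)"
  by (rule measurableI; simp add: space_hidden_info sets_hidden_info; blast intro: sigma_sets.Basic)+

lemma sets_location_info: "sets (location_info M X L) = sigma_sets (space M)
     {X n l -` B \<inter> space M | n l B. (n, l) \<in> sensors L \<and> B \<in> sets borel}"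
  unfolding location_info_def by (rule sets_measure_of) auto

lemma space_location_info: "space (location_info M X L) = space M"
  unfolding location_info_def by (rule space_measure_of) auto

lemma measurable_location_info:
  "(n, l) \<in> sensors L \<Longrightarrow> X n l \<in> borel_measurable (location_info M X L)"
  by (rule measurableI; simp add: space_location_info sets_location_info; blast intro: sigma_sets.Basic)

text \<open>Independence of the change point and the locations is given on the level of sigma-algebras; this is
  its form for expectations.\<close>

lemma expectation_locations_times_change_event:
  assumes F: "F \<in> borel_measurable (location_info M X L)" and i: "integrable M F"
  shows "(\<integral>\<omega>. indicator {\<omega>\<in>space M. t \<omega> \<in> S} \<omega> * F \<omega> \<partial>M) = prob {\<omega>\<in>space M. t \<omega> \<in> S} * (\<integral>\<omega>. F \<omega> \<partial>M)"
proof -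
  have *: "indep_var borel (indicator {\<omega>\<in>space M. t \<omega> \<in> S} :: _ \<Rightarrow> real) borel F"
    unfolding indep_var_eq
  proof (intro conjI)
    show "random_variable borel F" using i by measurable
    have 1: "sigma_sets (space M) {(indicator {\<omega>\<in>space M. t \<omega> \<in> S} :: _ \<Rightarrow> real) -` A \<inter> space M | A. A \<in> sets borel}
        \<subseteq> {t -` A \<inter> space M | A. True}" (is "sigma_sets _ ?G \<subseteq> ?H")
    proof -
      have H: "?H = sets (vimage_algebra (space M) t (count_space UNIV))"
        by (subst sets_vimage_algebra2) auto
      have "?G \<subseteq> ?H"
      proof safe
        fix A :: "real set"
        show "\<exists>B. indicator {\<omega>\<in>space M. t \<omega> \<in> S} -` A \<inter> space M = t -` B \<inter> space M \<and> True"
          by (rule exI[of _ "{m. indicator S m \<in> A}"]) (auto simp: indicator_def)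
      qed
      then have "sigma_sets (space (vimage_algebra (space M) t (count_space UNIV))) ?G
          \<subseteq> sets (vimage_algebra (space M) t (count_space UNIV))"
        by (intro sets.sigma_sets_subset) (simp only: H)
      then show ?thesis by (simp only: H space_vimage_algebra)
    qed
    have 2: "sigma_sets (space M) {F -` A \<inter> space M | A. A \<in> sets borel} \<subseteq> sets (location_info M X L)"
    proof -
      have "{F -` A \<inter> space M | A. A \<in> sets borel} \<subseteq> sets (location_info M X L)"
        using measurable_sets[OF F] by (auto simp: space_location_info)
      then show ?thesis
        using sets.sigma_sets_subset[of _ "location_info M X L"] by (simp only: space_location_info)
    qed
    show "indep_set (sigma_sets (space M) {(indicator {\<omega>\<in>space M. t \<omega> \<in> S} :: _ \<Rightarrow> real) -` A \<inter> space M | A. A \<in> sets borel})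
       (sigma_sets (space M) {F -` A \<inter> space M | A. A \<in> sets borel})"
      using X_indep_t unfolding indep_set_def
      by (rule indep_sets_mono_sets) (use 1 2 in \<open>simp split: bool.split\<close>)
  qed measurable
  show ?thesis
    by (subst indep_var_lebesgue_integral[OF *])
      (use i in \<open>auto simp: emeasure_eq_measure Int_def intro!: arg_cong[where f=prob]\<close>)
qed

text \<open>Conditioning on change point and locations turns the samples into a product of Gaussian
  probabilities, which on the event \<open>t \<in> S\<close> depends on the locations alone; the independence of the
  locations does the rest. A set \<open>S\<close> of change points is admitted, provided that all of them produce
  the same radii at the times in \<open>J\<close>, in order to treat \<open>t = k\<close> and \<open>t > n\<close> at once.\<close>

lemma prob_rectangle:
  assumes J: "finite J" "J \<subseteq> sensors L"
    and CB: "\<And>n l. (n, l) \<in> J \<Longrightarrow> C n l \<in> sets borel" "\<And>n l. (n, l) \<in> J \<Longrightarrow> B n l \<in> sets borel"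
    and r: "\<And>m n l. m \<in> S \<Longrightarrow> (n, l) \<in> J \<Longrightarrow> event_radius Rmax m n = r n"
  shows "prob {\<omega>\<in>space M. t \<omega> \<in> S \<and> (\<forall>(n, l)\<in>J. X n l \<omega> \<in> C n l \<and> Y n l \<omega> \<in> B n l)}
    = prob {\<omega>\<in>space M. t \<omega> \<in> S} * (\<Prod>(n, l)\<in>J. measure (obs_law (r n)) (C n l \<times> B n l))"
proof -
  let ?H = "hidden_info M t X L"
  let ?G = "\<lambda>n l x. measure (gaussian 0 (\<sigma>\<^sup>2 * variance_ratio (r n) x)) (B n l)"
  interpret H: finite_measure_subalgebra M ?H by (rule finite_measure_subalgebra_hidden_info)
  define D where "D = {\<omega>\<in>space M. t \<omega> \<in> S \<and> (\<forall>j\<in>J. X (fst j) (snd j) \<omega> \<in> C (fst j) (snd j))}"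
  define V where "V = {\<omega>\<in>space M. \<forall>(n, l)\<in>J. Y n l \<omega> \<in> B n l}"
  define F where "F \<omega> = (\<Prod>j\<in>J. indicator (C (fst j) (snd j)) (X (fst j) (snd j) \<omega>)
      * ?G (fst j) (snd j) (X (fst j) (snd j) \<omega>))" for \<omega>
  have jS: "j \<in> J \<Longrightarrow> (fst j, snd j) \<in> sensors L" for j using J by auto
  have [measurable]: "j \<in> J \<Longrightarrow> C (fst j) (snd j) \<in> sets borel"
     "j \<in> J \<Longrightarrow> B (fst j) (snd j) \<in> sets borel" for j using CB by auto
  note [measurable] = measurable_hidden_info(1) measurable_hidden_info(2)[OF jS]
    X_measurable[OF jS] Y_measurable[OF jS] measurable_location_info[OF jS]
  have cnt: "countable J" using J countable_finite by auto
  have DH: "D \<in> sets ?H" unfolding D_def space_hidden_info[symmetric] using J(1) cnt by measurable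
  have DM: "D \<in> sets M" using DH subalgebra_hidden by (auto simp: subalgebra_def)
  have V_alt: "V = {\<omega>\<in>space M. \<forall>j\<in>J. Y (fst j) (snd j) \<omega> \<in> B (fst j) (snd j)}"
    by (auto simp: V_def)
  have VM: "V \<in> sets M" unfolding V_alt using J(1) cnt by measurable
  have F_bd: "0 \<le> F \<omega>" "F \<omega> \<le> 1" for \<omega>
    using prob_space.prob_le_1[OF prob_space_gaussian]
    by (auto simp: F_def intro!: prod_nonneg prod_le_1 mult_le_one split: split_indicator)
  have F_loc: "F \<in> borel_measurable (location_info M X L)"
    unfolding F_def by measurable
  have F_M[measurable]: "F \<in> borel_measurable M" unfolding F_def by measurable
  have F_int: "integrable M F"
    by (rule integrable_const_bound[of _ 1]) (use F_bd in auto)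
  have ae: "AE \<omega> in M. cprob M ?H V \<omega> = (\<Prod>(n, l)\<in>J. measure (sample_law u Rmax \<sigma> \<gamma> \<theta> (t \<omega>) n (dist (X n l \<omega>) src)) (B n l))"
  proof -
    have 1: "AE \<omega> in M. cprob M ?H V \<omega> = (\<Prod>(n, l)\<in>J. cprob M ?H {\<omega> \<in> space M. Y n l \<omega> \<in> B n l} \<omega>)"
      unfolding V_def by (rule Y_cond_indep) (use J CB in auto)
    have 2: "AE \<omega> in M. \<forall>j\<in>J. cprob M ?H {\<omega> \<in> space M. Y (fst j) (snd j) \<omega> \<in> B (fst j) (snd j)} \<omega> =
        measure (sample_law u Rmax \<sigma> \<gamma> \<theta> (t \<omega>) (fst j) (dist (X (fst j) (snd j) \<omega>) src)) (B (fst j) (snd j))"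
      by (rule AE_finite_allI[OF J(1)], rule Y_cond_law) (use jS CB in auto)
    show ?thesis using 1 2
      by eventually_elim (auto intro!: prod.cong)
  qed
  have "prob {\<omega>\<in>space M. t \<omega> \<in> S \<and> (\<forall>(n, l)\<in>J. X n l \<omega> \<in> C n l \<and> Y n l \<omega> \<in> B n l)} = prob (D \<inter> V)"
    by (rule arg_cong[where f=prob]) (auto simp: D_def V_def)
  also have "\<dots> = (\<integral>\<omega>. indicator D \<omega> * indicator V \<omega> \<partial>M)"
    using DM VM by (simp add: indicator_inter_arith[symmetric])
  also have "\<dots> = (\<integral>\<omega>. indicator D \<omega> * cprob M ?H V \<omega> \<partial>M)"
    unfolding cprob_def
    by (rule H.real_cond_exp_intg(2)[symmetric])
      (use DH DM VM in \<open>auto simp: indicator_inter_arith[symmetric] emeasure_eq_measure intro!: integrable_real_indicator\<close>)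
  also have "\<dots> = (\<integral>\<omega>. indicator {\<omega>\<in>space M. t \<omega> \<in> S} \<omega> * F \<omega> \<partial>M)"
  proof (rule integral_cong_AE)
    show "AE \<omega> in M. indicator D \<omega> * cprob M ?H V \<omega> = indicator {\<omega>\<in>space M. t \<omega> \<in> S} \<omega> * F \<omega>"
      using ae AE_space
    proof eventually_elim
      case (elim \<omega>)
      show ?case
      proof (cases "\<omega> \<in> D")
        case True
        then have "t \<omega> \<in> S" by (simp add: D_def)
        with True show ?thesis
          unfolding elim F_def
          by (auto simp: D_def sample_law_eq r intro!: prod.cong)
      next
        case False
        then have "t \<omega> \<notin> S \<or> (\<exists>j\<in>J. X (fst j) (snd j) \<omega> \<notin> C (fst j) (snd j))"
          using elim by (auto simp: D_def)
        then have "t \<omega> \<notin> S \<or> F \<omega> = 0"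
          using J(1) unfolding F_def by (auto intro!: prod_zero bexI)
        with False show ?thesis by auto
      qed
    qed
  qed (use DM in \<open>auto simp: cprob_def\<close>)
  also have "\<dots> = prob {\<omega>\<in>space M. t \<omega> \<in> S} * (\<integral>\<omega>. F \<omega> \<partial>M)"
    by (rule expectation_locations_times_change_event[OF F_loc F_int])
  also have "(\<integral>\<omega>. F \<omega> \<partial>M) = (\<Prod>j\<in>J. \<integral>\<omega>. indicator (C (fst j) (snd j)) (X (fst j) (snd j) \<omega>)
      * ?G (fst j) (snd j) (X (fst j) (snd j) \<omega>) \<partial>M)"
    unfolding F_def
  proof (rule indep_vars_lebesgue_integral[OF J(1)])
    have "indep_vars (\<lambda>_. borel) (\<lambda>j. X (fst j) (snd j)) J"
      using indep_vars_subset[OF X_indep J(2)] by (simp add: case_prod_beta')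
    then show "indep_vars (\<lambda>_. borel) (\<lambda>j \<omega>. indicator (C (fst j) (snd j)) (X (fst j) (snd j) \<omega>)
      * ?G (fst j) (snd j) (X (fst j) (snd j) \<omega>)) J"
      by (rule indep_vars_compose2[where Y = "\<lambda>j x. indicator (C (fst j) (snd j)) x * ?G (fst j) (snd j) x"])
        measurable
    fix j assume [simp]: "j \<in> J"
    show "integrable M (\<lambda>\<omega>. indicator (C (fst j) (snd j)) (X (fst j) (snd j) \<omega>)
      * ?G (fst j) (snd j) (X (fst j) (snd j) \<omega>))"
      by (rule integrable_const_bound[of _ 1])
        (auto split: split_indicator intro: prob_space.prob_le_1[OF prob_space_gaussian])
  qed
  also have "\<dots> = (\<Prod>j\<in>J. measure (obs_law (r (fst j))) (C (fst j) (snd j) \<times> B (fst j) (snd j)))"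
  proof (rule prod.cong[OF refl])
    fix j assume j [simp]: "j \<in> J"
    have "measure (obs_law (r (fst j))) (C (fst j) (snd j) \<times> B (fst j) (snd j))
      = (\<integral>x. indicator (C (fst j) (snd j)) x * ?G (fst j) (snd j) x \<partial>distr M borel (X (fst j) (snd j)))"
      unfolding X_uniform[OF jS[OF j]] location_law_def[symmetric]
      by (rule measure_obs_law_Times) auto
    also have "\<dots> = (\<integral>\<omega>. indicator (C (fst j) (snd j)) (X (fst j) (snd j) \<omega>)
      * ?G (fst j) (snd j) (X (fst j) (snd j) \<omega>) \<partial>M)"
      by (rule integral_distr) measurable
    finally show "(\<integral>\<omega>. indicator (C (fst j) (snd j)) (X (fst j) (snd j) \<omega>)
      * ?G (fst j) (snd j) (X (fst j) (snd j) \<omega>) \<partial>M)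
      = measure (obs_law (r (fst j))) (C (fst j) (snd j) \<times> B (fst j) (snd j))" by simp
  qed
  finally show ?thesis by (simp add: case_prod_beta')
qed

section \<open>Independence given the change point\<close>

abbreviation change_in :: "nat set \<Rightarrow> 'a set" where
  "change_in S \<equiv> {\<omega>\<in>space M. t \<omega> \<in> S}"

definition given_change :: "nat set \<Rightarrow> 'a measure" where
  "given_change S = uniform_measure M (change_in S)"

lemma sets_given_change [measurable_cong, simp]: "sets (given_change S) = sets M"
  and space_given_change [simp]: "space (given_change S) = space M"
  by (simp_all add: given_change_def)

lemma change_in_events [measurable, simp]: "change_in S \<in> events"
proof -
  have "change_in S = t -` S \<inter> space M" by auto
  then show ?thesis using measurable_sets[OF t_measurable, of S] by simp
qed

lemma prob_space_given_change: "prob (change_in S) > 0 \<Longrightarrow> prob_space (given_change S)"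
  unfolding given_change_def by (rule prob_space_uniform_measure) (auto simp: emeasure_eq_measure)

lemma measure_given_change:
  assumes "prob (change_in S) > 0" "A \<in> sets M"
  shows "measure (given_change S) A = prob (change_in S \<inter> A) / prob (change_in S)"
  unfolding given_change_def
  by (rule measure_uniform_measure) (use assms in \<open>auto simp: emeasure_eq_measure\<close>)

lemma prob_change_eq: "prob (change_in {k}) = \<rho> * (1 - \<rho>) ^ k"
  using t_geometric[of k] by simp

lemma prob_change_le: "prob (change_in {..n}) = 1 - (1 - \<rho>) ^ (n + 1)"
proof (induction n)
  case 0
  show ?case using prob_change_eq[of 0] by (simp add: atMost_0)
next
  case (Suc n)
  have "change_in {..Suc n} = change_in {..n} \<union> change_in {Suc n}" by auto
  then have "prob (change_in {..Suc n}) = prob (change_in {..n}) + prob (change_in {Suc n})"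
    by (simp only:, intro finite_measure_Union) auto
  then show ?case unfolding Suc prob_change_eq by (simp add: algebra_simps)
qed

lemma prob_change_gt: "prob (change_in {n<..}) = (1 - \<rho>) ^ (n + 1)"
proof -
  have "change_in {n<..} = space M - change_in {..n}" by auto
  then have "prob (change_in {n<..}) = 1 - prob (change_in {..n})"
    using prob_compl[of "change_in {..n}"] by simp
  then show ?thesis unfolding prob_change_le by simp
qed

lemma prob_change_pos: "prob (change_in {k}) > 0" "prob (change_in {n<..}) > 0"
  unfolding prob_change_eq prob_change_gt using rho by auto

lemma event_radius_gt: "m \<in> {n<..} \<Longrightarrow> i \<le> n \<Longrightarrow> event_radius Rmax m i = 0"
  by (simp add: event_radius_def)

lemma measure_given_rectangle:
  assumes S: "prob (change_in S) > 0"
    and J: "finite J" "J \<subseteq> sensors L"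
    and CB: "\<And>j. j \<in> J \<Longrightarrow> C j \<in> sets borel" "\<And>j. j \<in> J \<Longrightarrow> B j \<in> sets borel"
    and r: "\<And>m j. m \<in> S \<Longrightarrow> j \<in> J \<Longrightarrow> event_radius Rmax m (fst j) = r (fst j)"
  shows "measure (given_change S) {\<omega>\<in>space M. \<forall>j\<in>J. obs j \<omega> \<in> C j \<times> B j}
    = (\<Prod>j\<in>J. measure (obs_law (r (fst j))) (C j \<times> B j))"
proof -
  have [measurable]: "j \<in> J \<Longrightarrow> C j \<in> sets borel" "j \<in> J \<Longrightarrow> B j \<in> sets borel"
    "j \<in> J \<Longrightarrow> obs j \<in> M \<rightarrow>\<^sub>M borel \<Otimes>\<^sub>M borel" for j
    using CB J by auto
  have cnt: "countable J" using J countable_finite by auto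
  have "prob {\<omega>\<in>space M. t \<omega> \<in> S \<and> (\<forall>(n, l)\<in>J. X n l \<omega> \<in> C (n, l) \<and> Y n l \<omega> \<in> B (n, l))}
    = prob (change_in S) * (\<Prod>(n, l)\<in>J. measure (obs_law (r n)) (C (n, l) \<times> B (n, l)))"
  proof (rule prob_rectangle[OF J])
    show "event_radius Rmax m n = r n" if "m \<in> S" "(n, l) \<in> J" for m n l
      using r[OF that] by simp
  qed (use CB in auto)
  also have "{\<omega>\<in>space M. t \<omega> \<in> S \<and> (\<forall>(n, l)\<in>J. X n l \<omega> \<in> C (n, l) \<and> Y n l \<omega> \<in> B (n, l))}
    = change_in S \<inter> {\<omega>\<in>space M. \<forall>j\<in>J. obs j \<omega> \<in> C j \<times> B j}"
    by (auto simp: obs_def split_beta' Ball_def)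
  finally show ?thesis
    using S J(1) cnt by (subst measure_given_change) (auto simp: case_prod_beta')
qed

lemma distr_obs_given_change:
  assumes S: "prob (change_in S) > 0" and j: "j \<in> sensors L"
    and r: "\<And>m. m \<in> S \<Longrightarrow> event_radius Rmax m (fst j) = r"
  shows "distr (given_change S) (borel \<Otimes>\<^sub>M borel) (obs j) = obs_law r"
proof -
  interpret G: prob_space "given_change S" by (rule prob_space_given_change[OF S])
  interpret O: prob_space "obs_law r" by (rule prob_space_obs_law)
  have [measurable]: "obs j \<in> given_change S \<rightarrow>\<^sub>M borel \<Otimes>\<^sub>M borel" using measurable_obs[OF j] by measurable
  show ?thesis
  proof (rule measure_eqI_generator_eq[where \<Omega>=UNIV and A="\<lambda>_. UNIV"
        and E="{a \<times> b | a b. a \<in> sets borel \<and> b \<in> sets borel}"])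
    fix A :: "((real^2) \<times> real) set" assume "A \<in> {a \<times> b | a b. a \<in> sets borel \<and> b \<in> sets borel}"
    then obtain a b where A: "A = a \<times> b" and [measurable]: "a \<in> sets borel" "b \<in> sets borel" by auto
    have "measure (distr (given_change S) (borel \<Otimes>\<^sub>M borel) (obs j)) A
      = measure (given_change S) {\<omega>\<in>space M. \<forall>j\<in>{j}. obs j \<omega> \<in> a \<times> b}"
      unfolding A by (subst measure_distr) (auto simp: vimage_def Int_def conj_commute)
    also have "\<dots> = (\<Prod>j\<in>{j}. measure (obs_law r) (a \<times> b))"
      by (rule measure_given_rectangle[OF S, where r="\<lambda>_. r"]) (use j r in auto)
    finally show "emeasure (distr (given_change S) (borel \<Otimes>\<^sub>M borel) (obs j)) A = emeasure (obs_law r) A"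
      using A by (simp add: emeasure_distr measure_distr G.emeasure_eq_measure O.emeasure_eq_measure)
  next
    show "Int_stable {a \<times> b |a b. a \<in> sets (borel :: (real^2) measure) \<and> b \<in> sets (borel :: real measure)}"
      by (rule Int_stable_pair_measure_generator)
    show "sets (distr (given_change S) (borel \<Otimes>\<^sub>M borel) (obs j)) = sigma_sets UNIV
       {a \<times> b |a b. a \<in> sets (borel :: (real^2) measure) \<and> b \<in> sets (borel :: real measure)}"
      "sets (obs_law r) = sigma_sets UNIV
       {a \<times> b |a b. a \<in> sets (borel :: (real^2) measure) \<and> b \<in> sets (borel :: real measure)}"
      unfolding sets_obs_law sets_distr sets_pair_measure space_borel UNIV_Times_UNIV by (rule refl)+
    show "range (\<lambda>_. UNIV) \<subseteq> {a \<times> b |a b. a \<in> sets (borel :: (real^2) measure) \<and> b \<in> sets (borel :: real measure)}"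
      by (intro image_subsetI CollectI exI[of _ UNIV]) simp
    fix i :: nat
    show "emeasure (distr (given_change S) (borel \<Otimes>\<^sub>M borel) (obs j)) UNIV \<noteq> \<infinity>"
      using sets.top[of "(borel :: (real^2) measure) \<Otimes>\<^sub>M (borel :: real measure)"]
      by (simp add: emeasure_distr G.emeasure_eq_measure space_pair_measure)
  qed auto
qed

text \<open>Products of Borel sets form an intersection-stable generator, to which independence may be
  restricted.\<close>

lemma indep_obs_given_change:
  assumes S: "prob (change_in S) > 0" and J: "finite J" "J \<subseteq> sensors L"
    and r: "\<And>m j. m \<in> S \<Longrightarrow> j \<in> J \<Longrightarrow> event_radius Rmax m (fst j) = r (fst j)"
  shows "prob_space.indep_vars (given_change S) (\<lambda>_. borel \<Otimes>\<^sub>M borel) obs J"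
proof -
  interpret G: prob_space "given_change S" by (rule prob_space_given_change[OF S])
  define E where "E j = {obs j -` (a \<times> b) \<inter> space M | a b.
      a \<in> sets (borel :: (real^2) measure) \<and> b \<in> sets (borel :: real measure)}" for j
  have mo: "j \<in> J \<Longrightarrow> obs j \<in> given_change S \<rightarrow>\<^sub>M borel \<Otimes>\<^sub>M borel" for j
    using measurable_obs[of j] J by auto
  have rect: "measure (given_change S) {\<omega>\<in>space M. \<forall>j\<in>K. obs j \<omega> \<in> C j \<times> B j}
    = (\<Prod>j\<in>K. measure (obs_law (r (fst j))) (C j \<times> B j))"
    if "K \<subseteq> J" "\<And>j. j \<in> K \<Longrightarrow> C j \<in> sets borel" "\<And>j. j \<in> K \<Longrightarrow> B j \<in> sets borel" for K C B
    by (rule measure_given_rectangle[OF S finite_subset[OF that(1) J(1)]]) (use that J r in auto)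
  have "G.indep_sets E J"
  proof (rule G.indep_setsI)
    fix j assume "j \<in> J"
    then show "E j \<subseteq> G.events"
      using measurable_sets[OF mo[of j]] by (auto simp: E_def simp del: vimage_Times)
  next
    fix A K assume K: "K \<noteq> {}" "K \<subseteq> J" "finite K" "\<forall>j\<in>K. A j \<in> E j"
    then have "\<forall>j\<in>K. \<exists>ab. A j = obs j -` (fst ab \<times> snd ab) \<inter> space M \<and> fst ab \<in> sets borel \<and> snd ab \<in> sets borel"
      unfolding E_def by fastforce
    then obtain ab where ab: "\<And>j. j \<in> K \<Longrightarrow> A j = obs j -` (fst (ab j) \<times> snd (ab j)) \<inter> space M"
      "\<And>j. j \<in> K \<Longrightarrow> fst (ab j) \<in> sets borel" "\<And>j. j \<in> K \<Longrightarrow> snd (ab j) \<in> sets borel"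
      by metis
    have "(\<Inter>j\<in>K. A j) = {\<omega>\<in>space M. \<forall>j\<in>K. obs j \<omega> \<in> fst (ab j) \<times> snd (ab j)}"
      using K(1) ab(1) by (auto simp del: mem_Times_iff)
    then have "G.prob (\<Inter>j\<in>K. A j) = (\<Prod>j\<in>K. measure (obs_law (r (fst j))) (fst (ab j) \<times> snd (ab j)))"
      using rect[OF K(2), of "\<lambda>j. fst (ab j)" "\<lambda>j. snd (ab j)"] ab by simp
    moreover have "G.prob (A j) = measure (obs_law (r (fst j))) (fst (ab j) \<times> snd (ab j))" if "j \<in> K" for j
    proof -
      have "A j = {\<omega>\<in>space M. \<forall>j\<in>{j}. obs j \<omega> \<in> fst (ab j) \<times> snd (ab j)}"
        using ab(1)[OF that] by (auto simp del: mem_Times_iff)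
      then show ?thesis
        using rect[of "{j}" "\<lambda>j. fst (ab j)" "\<lambda>j. snd (ab j)"] ab(2,3)[OF that] that K(2)
        by (simp only: insert_subset empty_subsetI subsetD singletonD prod.insert finite.emptyI
            empty_iff not_False_eq_True prod.empty mult_1_right simp_thms)
          (auto simp del: mem_Times_iff)
    qed
    ultimately show "G.prob (\<Inter>j\<in>K. A j) = (\<Prod>j\<in>K. G.prob (A j))" by simp
  qed
  moreover have "Int_stable (E j)" for j
    unfolding E_def Int_stable_def
  proof safe
    fix a b c d assume m: "a \<in> sets (borel :: (real^2) measure)" "b \<in> sets (borel :: real measure)"
      "c \<in> sets (borel :: (real^2) measure)" "d \<in> sets (borel :: real measure)"
    show "\<exists>e f. obs j -` (a \<times> b) \<inter> space M \<inter> (obs j -` (c \<times> d) \<inter> space M) = obs j -` (e \<times> f) \<inter> space M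
       \<and> e \<in> sets borel \<and> f \<in> sets borel"
      by (rule exI[of _ "a \<inter> c"], rule exI[of _ "b \<inter> d"]) (use m in auto)
  qed
  ultimately have i: "G.indep_sets (\<lambda>j. sigma_sets (space M) (E j)) J"
    using G.indep_sets_sigma[of E J] by simp
  have sub: "{obs j -` A \<inter> space M | A. A \<in> sets (borel \<Otimes>\<^sub>M borel)} \<subseteq> sigma_sets (space M) (E j)" for j
  proof -
    have "{obs j -` A \<inter> space M | A. A \<in> sigma_sets (space borel \<times> space borel)
        {a \<times> b | a b. a \<in> sets borel \<and> b \<in> sets borel}}
      = sigma_sets (space M) {obs j -` A \<inter> space M | A. A \<in> {a \<times> b | a b. a \<in> sets borel \<and> b \<in> sets borel}}"
      by (rule sigma_sets_vimage_commute) auto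
    also have "{obs j -` A \<inter> space M | A. A \<in> {a \<times> b | a b. a \<in> sets borel \<and> b \<in> sets borel}} = E j"
      unfolding E_def by blast
    finally show ?thesis by (simp add: sets_pair_measure)
  qed
  show ?thesis
    unfolding G.indep_vars_def2 space_given_change
    using mo G.indep_sets_mono_sets[OF i, of "\<lambda>j. {obs j -` A \<inter> space M | A. A \<in> sets (borel \<Otimes>\<^sub>M borel)}"] sub
    by blast
qed

text \<open>The expectation of a product over sensors is the product of the expectations under the
  single-observation laws; every later computation of a moment or of a change of measure is an
  instance.\<close>

lemma nn_integral_prod_obs:
  fixes h :: "nat \<times> nat \<Rightarrow> (real^2) \<times> real \<Rightarrow> ennreal"
  assumes S: "prob (change_in S) > 0" and J: "finite J" "J \<subseteq> sensors L"
    and r: "\<And>m j. m \<in> S \<Longrightarrow> j \<in> J \<Longrightarrow> event_radius Rmax m (fst j) = r (fst j)"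
    and h [measurable]: "\<And>j. j \<in> J \<Longrightarrow> h j \<in> borel_measurable (borel \<Otimes>\<^sub>M borel)"
  shows "(\<integral>\<^sup>+ \<omega>. (\<Prod>j\<in>J. h j (obs j \<omega>)) \<partial>given_change S) = (\<Prod>j\<in>J. \<integral>\<^sup>+ z. h j z \<partial>obs_law (r (fst j)))"
proof -
  interpret G: prob_space "given_change S" by (rule prob_space_given_change[OF S])
  have "G.indep_vars (\<lambda>_. borel) (\<lambda>j \<omega>. h j (obs j \<omega>)) J"
    by (rule G.indep_vars_compose2[OF indep_obs_given_change[OF S J r]]) auto
  then have "(\<integral>\<^sup>+ \<omega>. (\<Prod>j\<in>J. h j (obs j \<omega>)) \<partial>given_change S)
      = (\<Prod>j\<in>J. \<integral>\<^sup>+ \<omega>. h j (obs j \<omega>) \<partial>given_change S)"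
    by (intro G.indep_vars_nn_integral J) auto
  also have "\<dots> = (\<Prod>j\<in>J. \<integral>\<^sup>+ z. h j z \<partial>obs_law (r (fst j)))"
  proof (rule prod.cong[OF refl])
    fix j assume j: "j \<in> J"
    then have jS: "j \<in> sensors L" using J by auto
    have "distr (given_change S) (borel \<Otimes>\<^sub>M borel) (obs j) = obs_law (r (fst j))"
      by (rule distr_obs_given_change[OF S jS]) (use r j in auto)
    then have "(\<integral>\<^sup>+ z. h j z \<partial>obs_law (r (fst j))) = (\<integral>\<^sup>+ z. h j z \<partial>distr (given_change S) (borel \<Otimes>\<^sub>M borel) (obs j))"
      by simp
    also have "\<dots> = (\<integral>\<^sup>+ \<omega>. h j (obs j \<omega>) \<partial>given_change S)"
      by (rule nn_integral_distr) (use measurable_obs[OF jS] h[OF j] in auto)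
    finally show "(\<integral>\<^sup>+ \<omega>. h j (obs j \<omega>) \<partial>given_change S) = (\<integral>\<^sup>+ z. h j z \<partial>obs_law (r (fst j)))" by simp
  qed
  finally show ?thesis .
qed

section \<open>Change of measure\<close>

definition sensors_upto :: "nat \<Rightarrow> (nat \<times> nat) set" where
  "sensors_upto n = {1..n} \<times> {..<L}"

text \<open>The likelihood ratio of ``change at \<open>k\<close>'' to ``no change yet'' for the observations up to time \<open>n\<close>;
  factors of sensors that the event has not reached are 1.\<close>

definition LR :: "nat \<Rightarrow> nat \<Rightarrow> 'a \<Rightarrow> real" where
  "LR k n \<omega> = (\<Prod>j\<in>sensors_upto n. likelihood_ratio (event_radius Rmax k (fst j)) (obs j \<omega>))"

lemma sensors_upto: "finite (sensors_upto n)" "sensors_upto n \<subseteq> sensors L"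
  by (auto simp: sensors_upto_def sensors_def)

lemma sensors_upto_iff: "j \<in> sensors_upto n \<longleftrightarrow> j \<in> sensors L \<and> fst j \<le> n"
  by (cases j) (auto simp: sensors_upto_def sensors_def)

lemma LR_pos: "0 < LR k n \<omega>"
  unfolding LR_def by (intro prod_pos) (simp add: likelihood_ratio_pos)

abbreviation observed :: "nat \<Rightarrow> 'a measure" where
  "observed n \<equiv> info M X Y L (enat n)"

text \<open>A generator of \<open>observed n\<close> that is stable under intersection and on which probabilities factorize.\<close>

definition rectangles :: "nat \<Rightarrow> 'a set set" where
  "rectangles n = {{\<omega>\<in>space M. \<forall>j\<in>sensors_upto n. obs j \<omega> \<in> C j \<times> B j} | C B.
     (\<forall>j. C j \<in> sets borel) \<and> (\<forall>j. B j \<in> sets borel)}"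

lemma space_info: "space (info M X Y L e) = space M"
  unfolding info_def by (rule space_measure_of) auto

lemma sets_info: "sets (info M X Y L e) = sigma_sets (space M)
     ({X k l -` B \<inter> space M | k l B. (k, l) \<in> sensors L \<and> enat k \<le> e \<and> B \<in> sets borel} \<union>
      {Y k l -` B \<inter> space M | k l B. (k, l) \<in> sensors L \<and> enat k \<le> e \<and> B \<in> sets borel})"
  unfolding info_def by (rule sets_measure_of) auto

lemma measurable_observed:
  assumes "(k, l) \<in> sensors L" "k \<le> n"
  shows "X k l \<in> borel_measurable (observed n)" "Y k l \<in> borel_measurable (observed n)"
  using assms
  by (intro measurableI; simp add: space_info sets_info; blast intro: sigma_sets.Basic)+

lemma measurable_obs_observed:
  "j \<in> sensors_upto n \<Longrightarrow> obs j \<in> observed n \<rightarrow>\<^sub>M borel \<Otimes>\<^sub>M borel"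
  using measurable_observed[of "fst j" "snd j" n] unfolding obs_def[abs_def]
  by (auto simp: sensors_upto_iff)

lemma subalgebra_observed: "subalgebra M (observed n)"
  unfolding subalgebra_def space_info sets_info
  by (intro conjI refl sets.sigma_sets_subset)
    (auto intro!: measurable_sets[OF X_measurable] measurable_sets[OF Y_measurable])

lemma observed_in_events: "A \<in> sets (observed n) \<Longrightarrow> A \<in> sets M"
  using subalgebra_observed by (auto simp: subalgebra_def)

lemma observed_mono:
  assumes "m \<le> n"
  shows "subalgebra (observed n) (observed m)"
proof -
  have le: "enat k \<le> enat m \<Longrightarrow> enat k \<le> enat n" for k using assms by simp
  show ?thesis
    unfolding subalgebra_def space_info sets_info
    by (intro conjI refl sigma_sets_mono' Un_mono Collect_mono impI; elim exE conjE;
        intro exI conjI; (assumption | rule le))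
qed

lemma measurable_LR_observed: "LR k n \<in> borel_measurable (observed n)"
  unfolding LR_def[abs_def]
  by (intro borel_measurable_prod measurable_compose[OF measurable_obs_observed measurable_likelihood_ratio])

lemma measurable_LR [measurable]: "LR k n \<in> borel_measurable M"
  by (rule measurable_from_subalg[OF subalgebra_observed measurable_LR_observed])

lemma sets_observed_rectangles: "sets (observed n) = sigma_sets (space M) (rectangles n)"
proof (rule equalityI)
  have cnt: "countable (sensors_upto n)" using sensors_upto countable_finite by auto
  have "rectangles n \<subseteq> sets (observed n)"
  proof
    fix A assume "A \<in> rectangles n"
    then obtain C B where A: "A = {\<omega>\<in>space (observed n). \<forall>j\<in>sensors_upto n. obs j \<omega> \<in> C j \<times> B j}"
      and [measurable]: "\<And>j. C j \<in> sets borel" "\<And>j. B j \<in> sets borel"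
      by (auto simp: rectangles_def space_info)
    note [measurable] = measurable_obs_observed
    show "A \<in> sets (observed n)" unfolding A using sensors_upto(1) cnt by measurable
  qed
  then show "sigma_sets (space M) (rectangles n) \<subseteq> sets (observed n)"
    using sets.sigma_sets_subset[of "rectangles n" "observed n"] by (simp add: space_info)
  show "sets (observed n) \<subseteq> sigma_sets (space M) (rectangles n)"
    unfolding sets_info
  proof (rule sigma_sets_mono, safe)
    fix k l and D :: "(real^2) set" assume a: "(k, l) \<in> sensors L" "enat k \<le> enat n" "D \<in> sets borel"
    have "X k l -` D \<inter> space M = {\<omega>\<in>space M. \<forall>j\<in>sensors_upto n. obs j \<omega> \<in> (if j = (k, l) then D else UNIV) \<times> UNIV}"
      using a by (auto simp: sensors_upto_iff obs_def split: if_splits)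
    also have "\<dots> \<in> rectangles n"
      unfolding rectangles_def by (intro CollectI exI conjI refl) (use a in auto)
    finally show "X k l -` D \<inter> space M \<in> sigma_sets (space M) (rectangles n)" by (rule sigma_sets.Basic)
  next
    fix k l and D :: "real set" assume a: "(k, l) \<in> sensors L" "enat k \<le> enat n" "D \<in> sets borel"
    have "Y k l -` D \<inter> space M = {\<omega>\<in>space M. \<forall>j\<in>sensors_upto n. obs j \<omega> \<in> UNIV \<times> (if j = (k, l) then D else UNIV)}"
      using a by (auto simp: sensors_upto_iff obs_def split: if_splits)
    also have "\<dots> \<in> rectangles n"
      unfolding rectangles_def by (intro CollectI exI conjI refl) (use a in auto)
    finally show "Y k l -` D \<inter> space M \<in> sigma_sets (space M) (rectangles n)" by (rule sigma_sets.Basic)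
  qed
qed

lemma Int_stable_rectangles: "Int_stable (rectangles n)"
  unfolding Int_stable_def
proof (intro ballI)
  fix A A' assume "A \<in> rectangles n" "A' \<in> rectangles n"
  then obtain C B C' B' where A: "A = {\<omega>\<in>space M. \<forall>j\<in>sensors_upto n. obs j \<omega> \<in> C j \<times> B j}"
      "A' = {\<omega>\<in>space M. \<forall>j\<in>sensors_upto n. obs j \<omega> \<in> C' j \<times> B' j}"
      and m: "\<And>j. C j \<in> sets borel" "\<And>j. B j \<in> sets borel" "\<And>j. C' j \<in> sets borel" "\<And>j. B' j \<in> sets borel"
    by (auto simp: rectangles_def)
  have "A \<inter> A' = {\<omega>\<in>space M. \<forall>j\<in>sensors_upto n. obs j \<omega> \<in> (C j \<inter> C' j) \<times> (B j \<inter> B' j)}"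
    unfolding A mem_Times_iff by auto
  then show "A \<inter> A' \<in> rectangles n"
    unfolding rectangles_def using m by (intro CollectI exI conjI) auto
qed

text \<open>Up to time \<open>n\<close> the likelihood ratio turns the law under \<open>t > n\<close> into the law under \<open>t = k\<close>. Both
  sides factorize on rectangles, where the identity is that of \<open>obs_law_eq_density_null\<close>, and two
  finite measures that agree on an intersection-stable generator are equal.\<close>

lemma change_of_measure:
  assumes "A \<in> sets (observed n)"
  shows "emeasure (given_change {k}) A = (\<integral>\<^sup>+ \<omega>. ennreal (LR k n \<omega>) * indicator A \<omega> \<partial>given_change {n<..})"
proof -
  let ?N1 = "restr_to_subalg (given_change {k}) (observed n)"
  let ?D = "density (given_change {n<..}) (\<lambda>\<omega>. ennreal (LR k n \<omega>))"
  let ?N2 = "restr_to_subalg ?D (observed n)"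
  interpret G: prob_space "given_change {k}" by (rule prob_space_given_change) (rule prob_change_pos)
  have sub: "subalgebra (given_change {k}) (observed n)" "subalgebra ?D (observed n)"
    using subalgebra_observed[of n] by (auto simp: subalgebra_def)
  have "?N1 = ?N2"
  proof (rule measure_eqI_generator_eq[OF Int_stable_rectangles[of n], where \<Omega>="space M" and A="\<lambda>_. space M"])
    show "rectangles n \<subseteq> Pow (space M)" by (auto simp: rectangles_def)
    show "sets ?N1 = sigma_sets (space M) (rectangles n)" "sets ?N2 = sigma_sets (space M) (rectangles n)"
      by (simp_all add: sets_restr_to_subalg[OF sub(1)] sets_restr_to_subalg[OF sub(2)] sets_observed_rectangles)
    have "space M = {\<omega>\<in>space M. \<forall>j\<in>sensors_upto n. obs j \<omega> \<in> UNIV \<times> UNIV}" by auto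
    then have sM: "space M \<in> rectangles n"
      unfolding rectangles_def
      by (intro CollectI exI[of _ "\<lambda>_. UNIV"] conjI allI) (auto simp del: mem_Times_iff UNIV_Times_UNIV)
    then show "range (\<lambda>_. space M) \<subseteq> rectangles n" by auto
    show "(\<Union>_. space M) = space M" by simp
    show "emeasure ?N1 (space M) \<noteq> \<infinity>" for i :: nat
      using sM by (subst emeasure_restr_to_subalg[OF sub(1)])
        (auto simp: sets_observed_rectangles G.emeasure_eq_measure)
    fix E assume E: "E \<in> rectangles n"
    then have EO: "E \<in> sets (observed n)" by (auto simp: sets_observed_rectangles)
    then have EM: "E \<in> sets M" by (rule observed_in_events)
    from E obtain C B where E_eq: "E = {\<omega>\<in>space M. \<forall>j\<in>sensors_upto n. obs j \<omega> \<in> C j \<times> B j}"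
      and [measurable]: "\<And>j. C j \<in> sets borel" "\<And>j. B j \<in> sets borel"
      by (auto simp: rectangles_def)
    have ind: "indicator E \<omega> = (\<Prod>j\<in>sensors_upto n. indicator (C j \<times> B j) (obs j \<omega>) :: ennreal)"
      if "\<omega> \<in> space M" for \<omega>
      using that sensors_upto(1)[of n] unfolding E_eq
      by (auto simp: indicator_def prod_zero_iff intro!: prod.neutral[symmetric])
    have "emeasure (given_change {k}) E = (\<integral>\<^sup>+ \<omega>. indicator E \<omega> \<partial>given_change {k})"
      using EM by simp
    also have "\<dots> = (\<integral>\<^sup>+ \<omega>. (\<Prod>j\<in>sensors_upto n. indicator (C j \<times> B j) (obs j \<omega>)) \<partial>given_change {k})"
      by (intro nn_integral_cong) (simp add: ind)
    also have "\<dots> = (\<Prod>j\<in>sensors_upto n. \<integral>\<^sup>+ z. indicator (C j \<times> B j) z \<partial>obs_law (event_radius Rmax k (fst j)))"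
      by (rule nn_integral_prod_obs[OF prob_change_pos(1) sensors_upto]) auto
    also have "\<dots> = (\<Prod>j\<in>sensors_upto n. \<integral>\<^sup>+ z. ennreal (likelihood_ratio (event_radius Rmax k (fst j)) z)
        * indicator (C j \<times> B j) z \<partial>obs_law 0)"
      by (subst obs_law_eq_density_null, subst nn_integral_density) auto
    also have "\<dots> = (\<integral>\<^sup>+ \<omega>. (\<Prod>j\<in>sensors_upto n. ennreal (likelihood_ratio (event_radius Rmax k (fst j)) (obs j \<omega>))
        * indicator (C j \<times> B j) (obs j \<omega>)) \<partial>given_change {n<..})"
      by (rule nn_integral_prod_obs[OF prob_change_pos(2) sensors_upto, symmetric])
        (auto simp: sensors_upto_iff intro: event_radius_gt)
    also have "\<dots> = (\<integral>\<^sup>+ \<omega>. ennreal (LR k n \<omega>) * indicator E \<omega> \<partial>given_change {n<..})"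
      by (intro nn_integral_cong)
        (simp add: ind prod.distrib LR_def prod_ennreal[symmetric] less_imp_le[OF likelihood_ratio_pos])
    also have "\<dots> = emeasure ?D E"
      using EM by (subst emeasure_density) auto
    finally show "emeasure ?N1 E = emeasure ?N2 E"
      by (simp add: emeasure_restr_to_subalg[OF sub(1) EO] emeasure_restr_to_subalg[OF sub(2) EO])
  qed
  then have "emeasure (given_change {k}) A = emeasure ?D A"
    using emeasure_restr_to_subalg[OF sub(1) assms] emeasure_restr_to_subalg[OF sub(2) assms] by simp
  also have "\<dots> = (\<integral>\<^sup>+ \<omega>. ennreal (LR k n \<omega>) * indicator A \<omega> \<partial>given_change {n<..})"
    by (rule emeasure_density) (use observed_in_events[OF assms] in auto)
  finally show ?thesis .
qed

section \<open>Exponential moments of the likelihood ratio\<close>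

text \<open>The mean information that one sample carries once the event covers the disk.\<close>

definition kl_rate :: real where
  "kl_rate = (\<integral>x. gauss_kl (variance_ratio Rmax x) \<partial>location_law)"

text \<open>Bounds the log-moment of order \<open>s\<close> of one likelihood ratio factor once the event covers the disk;
  the slope at 0 is \<open>kl_rate\<close> for either sign of \<open>s\<close>.\<close>

definition tilt_bound :: "real \<Rightarrow> real" where
  "tilt_bound s = s * kl_rate + 3 * snr\<^sup>2 * s\<^sup>2"

lemma gauss_kl_variance_ratio:
  "0 \<le> gauss_kl (variance_ratio r x)" "gauss_kl (variance_ratio r x) \<le> snr / 2"
  using gauss_kl_bounds[of "variance_ratio r x"] variance_ratio_bounds[of r x] by auto

lemma integrable_gauss_kl: "integrable location_law (\<lambda>x. gauss_kl (variance_ratio r x))"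
proof (rule finite_measure.integrable_const_bound[where B="snr / 2"])
  show "finite_measure location_law"
    by (rule prob_space.finite_measure[OF prob_space_location_law])
  show "AE x in location_law. norm (gauss_kl (variance_ratio r x)) \<le> snr / 2"
    using gauss_kl_variance_ratio by auto
  show "(\<lambda>x. gauss_kl (variance_ratio r x)) \<in> borel_measurable location_law"
    unfolding gauss_kl_def by measurable
qed

lemma kl_rate_bounds: "0 \<le> kl_rate" "kl_rate \<le> snr / 2"
proof -
  show "0 \<le> kl_rate"
    unfolding kl_rate_def by (intro Bochner_Integration.integral_nonneg gauss_kl_variance_ratio)
  have "kl_rate \<le> (\<integral>x. snr / 2 \<partial>location_law)"
    unfolding kl_rate_def
    using prob_space.finite_measure[OF prob_space_location_law]
    by (intro integral_mono integrable_gauss_kl gauss_kl_variance_ratio finite_measure.integrable_const)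
  also have "\<dots> = snr / 2"
    using prob_space.prob_space[OF prob_space_location_law] by simp
  finally show "kl_rate \<le> snr / 2" .
qed

text \<open>Makes the constants below independent of \<open>s\<close>.\<close>

lemma abs_tilt_bound_le_1:
  assumes s: "\<bar>s\<bar> * snr \<le> 1 / 2"
  shows "\<bar>tilt_bound s\<bar> \<le> 1"
proof -
  have "\<bar>s * kl_rate\<bar> \<le> \<bar>s\<bar> * (snr / 2)"
    unfolding abs_mult using kl_rate_bounds by (intro mult_left_mono) auto
  moreover have "(\<bar>s\<bar> * snr)\<^sup>2 \<le> (1 / 2)\<^sup>2"
    using s snr_pos by (intro power_mono) auto
  then have "3 * snr\<^sup>2 * s\<^sup>2 \<le> 3 / 4"
    by (simp add: power_mult_distrib power_divide mult.commute)
  moreover have "0 \<le> 3 * snr\<^sup>2 * s\<^sup>2" by simp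
  ultimately show ?thesis
    unfolding tilt_bound_def abs_le_iff using s by linarith
qed

context
  fixes s :: real
  assumes s: "\<bar>s\<bar> * snr \<le> 1 / 2"
begin

lemma nn_integral_likelihood_ratio_powr_obs_law:
  "(\<integral>\<^sup>+ z. likelihood_ratio r z powr s \<partial>obs_law r)
     = (\<integral>\<^sup>+ x. exp (half_tilt s (variance_ratio r x)) \<partial>location_law)"
proof -
  have "(\<integral>\<^sup>+ z. likelihood_ratio r z powr s \<partial>obs_law r)
      = (\<integral>\<^sup>+ x. (\<integral>\<^sup>+ y. ennreal (likelihood_ratio r (x, y) powr s) * ennreal (obs_density r (x, y)) \<partial>lborel) \<partial>location_law)"
    by (rule nn_integral_obs_law) measurable
  also have "\<dots> = (\<integral>\<^sup>+ x. exp (half_tilt s (variance_ratio r x)) \<partial>location_law)"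
  proof (rule nn_integral_cong)
    fix x
    have "s * (variance_ratio r x - 1) \<le> \<bar>s\<bar> * snr"
      using variance_ratio_bounds[of r x] by (intro mult_mono) auto
    then have "s * (variance_ratio r x - 1) < 1" using s by linarith
    from nn_integral_likelihood_ratio_powr[OF noise_var_pos _ this] variance_ratio_bounds(1)[of r x]
    show "(\<integral>\<^sup>+ y. ennreal (likelihood_ratio r (x, y) powr s) * ennreal (obs_density r (x, y)) \<partial>lborel)
        = exp (half_tilt s (variance_ratio r x))"
      by (simp add: likelihood_ratio_def obs_density_def variance_ratio_0)
  qed
  finally show ?thesis .
qed

lemma likelihood_ratio_moment_le_exp_1:
  "(\<integral>\<^sup>+ z. likelihood_ratio r z powr s \<partial>obs_law r) \<le> ennreal (exp 1)"
proof -
  have "(\<integral>\<^sup>+ z. likelihood_ratio r z powr s \<partial>obs_law r) \<le> (\<integral>\<^sup>+ x. ennreal (exp 1) \<partial>location_law)"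
    unfolding nn_integral_likelihood_ratio_powr_obs_law
    by (intro nn_integral_mono ennreal_leI exp_half_tilt_le(2)[OF variance_ratio_bounds s])
  also have "\<dots> = ennreal (exp 1)"
    using prob_space.emeasure_space_1[OF prob_space_location_law] by simp
  finally show ?thesis .
qed

lemma likelihood_ratio_moment_null:
  "(\<integral>\<^sup>+ z. likelihood_ratio 0 z powr s \<partial>obs_law 0) = 1"
  unfolding nn_integral_likelihood_ratio_powr_obs_law
  using prob_space.emeasure_space_1[OF prob_space_location_law]
  by (simp add: variance_ratio_0 half_tilt_def)

text \<open>The quadratic bound is averaged over the location first and only then bounded by an exponential, so
  that the mean divergence \<open>kl_rate\<close> appears to first order.\<close>

lemma likelihood_ratio_moment_saturated:
  "(\<integral>\<^sup>+ z. likelihood_ratio Rmax z powr s \<partial>obs_law Rmax) \<le> ennreal (exp (tilt_bound s))"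
proof -
  interpret U: finite_measure location_law
    by (rule prob_space.finite_measure[OF prob_space_location_law])
  let ?g = "\<lambda>x. 1 + s * gauss_kl (variance_ratio Rmax x) + 3 * snr\<^sup>2 * s\<^sup>2"
  have int: "integrable location_law ?g"
    using integrable_gauss_kl by auto
  have nonneg: "0 \<le> ?g x" for x
    using exp_half_tilt_le(1)[OF variance_ratio_bounds s, of Rmax x] exp_ge_zero order_trans by blast
  have "(\<integral>\<^sup>+ z. likelihood_ratio Rmax z powr s \<partial>obs_law Rmax) \<le> (\<integral>\<^sup>+ x. ennreal (?g x) \<partial>location_law)"
    unfolding nn_integral_likelihood_ratio_powr_obs_law
    by (intro nn_integral_mono ennreal_leI exp_half_tilt_le(1)[OF variance_ratio_bounds s])
  also have "\<dots> = ennreal (\<integral>x. ?g x \<partial>location_law)"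
    by (rule nn_integral_eq_integral[OF int]) (use nonneg in auto)
  also have "(\<integral>x. ?g x \<partial>location_law) = 1 + tilt_bound s"
    using prob_space.prob_space[OF prob_space_location_law] integrable_gauss_kl
    by (simp add: tilt_bound_def kl_rate_def)
  also have "ennreal (1 + tilt_bound s) \<le> ennreal (exp (tilt_bound s))"
    by (intro ennreal_leI exp_ge_add_one_self)
  finally show ?thesis .
qed

text \<open>Samples before the change contribute the factor 1, samples after the event has covered the disk at
  most \<open>exp (tilt_bound s)\<close>. The at most \<open>Rmax\<close> times in between are bounded crudely by \<open>exp 1\<close> per
  sensor, which costs the constant \<open>2 L Rmax\<close> in the exponent.\<close>

lemma LR_moment_bound:
  "(\<integral>\<^sup>+ \<omega>. LR k (k + j) \<omega> powr s \<partial>given_change {k})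
     \<le> ennreal (exp (real L * (real (j + 1) * tilt_bound s) + 2 * real L * real Rmax))"
proof -
  let ?r = "event_radius Rmax k"
  define \<beta> where "\<beta> = tilt_bound s"
  have \<beta>: "\<bar>\<beta>\<bar> \<le> 1" unfolding \<beta>_def by (rule abs_tilt_bound_le_1[OF s])
  \<comment> \<open>a bound for the log-moment at time \<open>i\<close>; \<open>\<beta> + 2 \<ge> 1\<close> dominates the crude bound while the event grows\<close>
  define w where "w i = (if i < k then 0 else \<beta> + (if i < k + Rmax then 2 else 0))" for i
  have W: "(\<integral>\<^sup>+ z. likelihood_ratio (?r i) z powr s \<partial>obs_law (?r i)) \<le> ennreal (exp (w i))" for i
  proof -
    consider "i < k" | "k \<le> i" "i < k + Rmax" | "k + Rmax \<le> i" by linarith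
    then show ?thesis
    proof cases
      case 1
      then show ?thesis using likelihood_ratio_moment_null by (simp add: event_radius_def w_def)
    next
      case 2
      have "ennreal (exp 1) \<le> ennreal (exp (w i))"
        using 2 \<beta> by (intro ennreal_leI) (auto simp: w_def)
      then show ?thesis using likelihood_ratio_moment_le_exp_1 order_trans by blast
    next
      case 3
      then have "?r i = Rmax" "w i = \<beta>" using Rmax_pos by (auto simp: event_radius_def w_def)
      then show ?thesis using likelihood_ratio_moment_saturated by (simp add: \<beta>_def)
    qed
  qed
  have sum_w: "(\<Sum>i\<le>k + j. w i) = real (j + 1) * \<beta> + 2 * real (min (j + 1) Rmax)" for j
  proof (induction j)
    case 0
    have "{..k} = insert k {..<k}" by auto
    then show ?case using Rmax_pos by (simp add: w_def)
  next
    case (Suc j)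
    show ?case using Suc by (simp add: w_def algebra_simps)
  qed
  have "(\<Sum>i\<in>{1..k + j}. w i) \<le> (\<Sum>i\<le>k + j. w i)"
  proof (rule sum_mono2)
    fix i assume "i \<in> {..k + j} - {1..k + j}"
    \<comment> \<open>time 0 carries no sensors but is a change point; its term in the sum is nonnegative\<close>
    then have "i = 0" by auto
    then show "0 \<le> w i" using \<beta> Rmax_pos by (auto simp: w_def)
  qed auto
  also have "\<dots> \<le> real (j + 1) * \<beta> + 2 * real Rmax" unfolding sum_w by simp
  finally have le: "(\<Sum>i\<in>{1..k + j}. w i) \<le> real (j + 1) * \<beta> + 2 * real Rmax" .
  have "(\<integral>\<^sup>+ \<omega>. LR k (k + j) \<omega> powr s \<partial>given_change {k})
      = (\<integral>\<^sup>+ \<omega>. (\<Prod>i\<in>sensors_upto (k + j). ennreal (likelihood_ratio (?r (fst i)) (obs i \<omega>) powr s)) \<partial>given_change {k})"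
    by (simp add: LR_def prod_powr_distrib prod_ennreal)
  also have "\<dots> = (\<Prod>i\<in>sensors_upto (k + j). \<integral>\<^sup>+ z. likelihood_ratio (?r (fst i)) z powr s \<partial>obs_law (?r (fst i)))"
    by (rule nn_integral_prod_obs[OF prob_change_pos(1) sensors_upto]) auto
  also have "\<dots> \<le> (\<Prod>i\<in>sensors_upto (k + j). ennreal (exp (w (fst i))))"
    by (intro prod_mono_ennreal W)
  also have "\<dots> = ennreal (exp (\<Sum>i\<in>sensors_upto (k + j). w (fst i)))"
    by (simp add: prod_ennreal exp_sum sensors_upto)
  also have "(\<Sum>i\<in>sensors_upto (k + j). w (fst i)) = real L * (\<Sum>i\<in>{1..k + j}. w i)"
    unfolding sensors_upto_def
    using sum.cartesian_product[of "\<lambda>i _. w i" "{..<L}" "{1..k + j}"]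
    by (simp add: case_prod_beta' sum_distrib_left)
  also have "ennreal (exp (real L * (\<Sum>i\<in>{1..k + j}. w i)))
      \<le> ennreal (exp (real L * (real (j + 1) * \<beta> + 2 * real Rmax)))"
    using le by (intro ennreal_leI) (simp add: mult_left_mono)
  finally show ?thesis by (simp add: \<beta>_def algebra_simps)
qed

text \<open>Markov's inequality. With \<open>s < 0\<close> it bounds the probability that the likelihood ratio is small, with
  \<open>s > 0\<close> the probability that it is large.\<close>

lemma LR_chernoff:
  "measure (given_change {k}) {\<omega>\<in>space M. 1 \<le> exp b * LR k (k + j) \<omega> powr s}
     \<le> exp (b + real L * (real (j + 1) * tilt_bound s) + 2 * real L * real Rmax)"
proof -
  interpret G: prob_space "given_change {k}" by (rule prob_space_given_change) (rule prob_change_pos)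
  let ?A = "{\<omega>\<in>space M. 1 \<le> exp b * LR k (k + j) \<omega> powr s}"
  have "emeasure (given_change {k}) ?A = (\<integral>\<^sup>+ \<omega>. indicator ?A \<omega> \<partial>given_change {k})"
    by simp
  also have "\<dots> \<le> (\<integral>\<^sup>+ \<omega>. ennreal (exp b) * ennreal (LR k (k + j) \<omega> powr s) \<partial>given_change {k})"
    by (intro nn_integral_mono) (auto simp: ennreal_mult[symmetric] split: split_indicator)
  also have "\<dots> = ennreal (exp b) * (\<integral>\<^sup>+ \<omega>. LR k (k + j) \<omega> powr s \<partial>given_change {k})"
    by (rule nn_integral_cmult) measurable
  also have "\<dots> \<le> ennreal (exp b) * ennreal (exp (real L * (real (j + 1) * tilt_bound s) + 2 * real L * real Rmax))"
    by (intro mult_left_mono LR_moment_bound) auto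
  also have "\<dots> = ennreal (exp (b + real L * (real (j + 1) * tilt_bound s) + 2 * real L * real Rmax))"
    by (simp add: ennreal_mult[symmetric] exp_add algebra_simps)
  finally show ?thesis by (simp add: G.emeasure_eq_measure)
qed

end

section \<open>Posterior probability and likelihood ratio\<close>

text \<open>The change of measure in unconditional form.\<close>

lemma LR_integral_no_change:
  assumes A: "A \<in> sets (observed n)"
  shows "integrable M (\<lambda>\<omega>. LR k n \<omega> * indicator A \<omega> * indicator (change_in {n<..}) \<omega>)"
    and "prob (change_in {k}) * (\<integral>\<omega>. LR k n \<omega> * indicator A \<omega> * indicator (change_in {n<..}) \<omega> \<partial>M)
       = prob (change_in {n<..}) * prob (change_in {k} \<inter> A)"
proof -
  interpret G: prob_space "given_change {k}" by (rule prob_space_given_change) (rule prob_change_pos)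
  let ?f = "\<lambda>\<omega>. LR k n \<omega> * indicator A \<omega> * indicator (change_in {n<..}) \<omega>"
  let ?c = "prob (change_in {n<..})" and ?p = "prob (change_in {k})"
  have [measurable]: "A \<in> sets M" by (rule observed_in_events[OF A])
  have pos: "?c > 0" "?p > 0" by (rule prob_change_pos)+
  have "ennreal (prob (change_in {k} \<inter> A) / ?p) = emeasure (given_change {k}) A"
    by (simp only: G.emeasure_eq_measure measure_given_change[OF prob_change_pos(1) \<open>A \<in> sets M\<close>])
  also have "\<dots> = (\<integral>\<^sup>+ \<omega>. ennreal (LR k n \<omega>) * indicator A \<omega> \<partial>given_change {n<..})"
    by (rule change_of_measure[OF A])
  also have "\<dots> = (\<integral>\<^sup>+ \<omega>. ennreal (LR k n \<omega>) * indicator A \<omega> * indicator (change_in {n<..}) \<omega> \<partial>M) / emeasure M (change_in {n<..})"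
    unfolding given_change_def by (rule nn_integral_uniform_measure) measurable
  also have "(\<integral>\<^sup>+ \<omega>. ennreal (LR k n \<omega>) * indicator A \<omega> * indicator (change_in {n<..}) \<omega> \<partial>M) = (\<integral>\<^sup>+ \<omega>. ennreal (?f \<omega>) \<partial>M)"
    by (intro nn_integral_cong) (auto split: split_indicator)
  finally have eq: "ennreal (prob (change_in {k} \<inter> A) / ?p) = (\<integral>\<^sup>+ \<omega>. ennreal (?f \<omega>) \<partial>M) / ennreal ?c"
    by (simp only: emeasure_eq_measure)
  have nn: "0 \<le> ?f \<omega>" for \<omega> using LR_pos[of k n \<omega>] by simp
  have "(\<integral>\<^sup>+ \<omega>. ennreal (?f \<omega>) \<partial>M) \<noteq> \<infinity>"
  proof
    assume "(\<integral>\<^sup>+ \<omega>. ennreal (?f \<omega>) \<partial>M) = \<infinity>"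
    then show False using eq pos by (simp add: ennreal_top_divide)
  qed
  then show int: "integrable M ?f"
    by (intro integrableI_nonneg) (use nn in \<open>auto simp: top.not_eq_extremum\<close>)
  have "(\<integral>\<^sup>+ \<omega>. ennreal (?f \<omega>) \<partial>M) = ennreal (\<integral>\<omega>. ?f \<omega> \<partial>M)"
    by (rule nn_integral_eq_integral[OF int]) (use nn in auto)
  moreover have "0 \<le> (\<integral>\<omega>. ?f \<omega> \<partial>M)" by (intro Bochner_Integration.integral_nonneg nn)
  ultimately have "prob (change_in {k} \<inter> A) / ?p = (\<integral>\<omega>. ?f \<omega> \<partial>M) / ?c"
    using eq pos by (simp add: divide_ennreal)
  then show "?p * (\<integral>\<omega>. ?f \<omega> \<partial>M) = ?c * prob (change_in {k} \<inter> A)"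
    using pos by (simp add: field_simps)
qed

abbreviation posterior :: "nat \<Rightarrow> 'a \<Rightarrow> real" where
  "posterior \<equiv> no_change_posterior M t X Y L"

lemma posterior_eq: "posterior n = real_cond_exp M (observed n) (indicator (change_in {n<..}))"
  by (simp add: no_change_posterior_def cprob_def)

lemma measurable_posterior: "posterior n \<in> borel_measurable (observed n)"
  unfolding posterior_eq by (rule borel_measurable_cond_exp)

lemma measurable_posterior_M [measurable]: "posterior n \<in> borel_measurable M"
  by (rule measurable_from_subalg[OF subalgebra_observed measurable_posterior])

lemma finite_measure_subalgebra_observed: "finite_measure_subalgebra M (observed n)"
  by unfold_locales (rule subalgebra_observed)

text \<open>By the change of measure, \<open>P(t = k) LR k n \<cdot> posterior n / P(t > n)\<close> is a version of the conditional
  probability of \<open>t = k\<close>, hence at most 1. The proof integrates over the observable event \<open>A\<close> where this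
  fails and finds that \<open>A\<close> is null.\<close>

lemma posterior_LR_bound:
  "AE \<omega> in M. prob (change_in {k}) * LR k n \<omega> * posterior n \<omega> \<le> prob (change_in {n<..})"
proof -
  interpret F: finite_measure_subalgebra M "observed n" by (rule finite_measure_subalgebra_observed)
  let ?c = "prob (change_in {n<..})" and ?p = "prob (change_in {k})"
  note [measurable] = measurable_posterior[of n] measurable_LR_observed[of k n]
  define A where "A = {\<omega>\<in>space (observed n). ?c < ?p * LR k n \<omega> * posterior n \<omega>}"
  have AO[measurable]: "A \<in> sets (observed n)" unfolding A_def by measurable
  have AM[measurable]: "A \<in> sets M" by (rule observed_in_events[OF AO])
  define f where "f \<omega> = LR k n \<omega> * indicator A \<omega>" for \<omega>
  have f: "f \<in> borel_measurable (observed n)" unfolding f_def[abs_def] by measurable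
  have int: "integrable M (\<lambda>\<omega>. f \<omega> * indicator (change_in {n<..}) \<omega>)"
    unfolding f_def by (rule LR_integral_no_change(1)[OF AO])
  have i2: "integrable M (\<lambda>\<omega>. f \<omega> * posterior n \<omega>)"
    "(\<integral>\<omega>. f \<omega> * posterior n \<omega> \<partial>M) = (\<integral>\<omega>. f \<omega> * indicator (change_in {n<..}) \<omega> \<partial>M)"
    unfolding posterior_eq using F.real_cond_exp_intg[OF int f] by auto
  have "?p * (\<integral>\<omega>. f \<omega> * posterior n \<omega> \<partial>M) = ?c * prob (change_in {k} \<inter> A)"
    unfolding i2(2) unfolding f_def by (rule LR_integral_no_change(2)[OF AO])
  also have "\<dots> \<le> ?c * prob A"
    by (intro mult_left_mono finite_measure_mono) auto
  finally have le: "?p * (\<integral>\<omega>. f \<omega> * posterior n \<omega> \<partial>M) \<le> ?c * prob A" .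
  \<comment> \<open>nonnegative, and positive exactly on \<open>A\<close>, but of integral at most 0\<close>
  define g where "g \<omega> = ?p * (f \<omega> * posterior n \<omega>) - ?c * indicator A \<omega>" for \<omega>
  have gint: "integrable M g"
    unfolding g_def by (intro Bochner_Integration.integrable_diff integrable_mult_right i2)
      (auto intro!: integrable_mult_right integrable_real_indicator simp: emeasure_eq_measure)
  have g0: "0 \<le> g \<omega>" for \<omega>
    by (auto simp: g_def f_def A_def mult.assoc split: split_indicator)
  have "(\<integral>\<omega>. g \<omega> \<partial>M) = ?p * (\<integral>\<omega>. f \<omega> * posterior n \<omega> \<partial>M) - ?c * prob A"
    unfolding g_def using i2(1)
    by (subst Bochner_Integration.integral_diff)
      (auto intro!: integrable_mult_right integrable_real_indicator simp: emeasure_eq_measure)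
  then have "(\<integral>\<omega>. g \<omega> \<partial>M) = 0" using le integral_nonneg_AE[of g M] g0 by simp
  then have "AE \<omega> in M. g \<omega> = 0"
    using integral_nonneg_eq_0_iff_AE[OF gint] g0 by simp
  then show ?thesis
    using AE_space
  proof eventually_elim
    case (elim \<omega>)
    show ?case
    proof (rule ccontr)
      assume "\<not> ?thesis"
      then have "\<omega> \<in> A" using elim by (simp add: A_def space_info)
      then show False using elim by (auto simp: g_def f_def A_def mult.assoc)
    qed
  qed
qed

section \<open>The posterior threshold time\<close>

abbreviation T_post :: "real \<Rightarrow> 'a \<Rightarrow> enat" where
  "T_post \<equiv> T_RP M t X Y L"

definition total_rate :: real where
  "total_rate = real L * kl_rate + \<bar>ln (1 - \<rho>)\<bar>"

lemma abs_ln_rho: "\<bar>ln (1 - \<rho>)\<bar> = - ln (1 - \<rho>)" "ln (1 - \<rho>) < 0"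
  using rho by auto

lemma total_rate_pos: "total_rate > 0"
  using kl_rate_bounds(1) abs_ln_rho unfolding total_rate_def by (intro add_nonneg_pos mult_nonneg_nonneg) auto

lemma one_minus_rho_power: "(1 - \<rho>) ^ n = exp (real n * ln (1 - \<rho>))"
  using rho by (simp add: exp_of_nat_mult)

lemma T_post_le_iff: "T_post \<alpha> \<omega> \<le> enat n \<longleftrightarrow> (\<exists>m\<le>n. posterior m \<omega> \<le> \<alpha>)"
proof -
  have "T_post \<alpha> \<omega> \<le> enat n \<longleftrightarrow> T_post \<alpha> \<omega> < enat (Suc n)"
    by (cases "T_post \<alpha> \<omega>") auto
  also have "\<dots> \<longleftrightarrow> (\<exists>m\<le>n. posterior m \<omega> \<le> \<alpha>)"
    unfolding T_RP_def Inf_less_iff by (auto simp: less_Suc_eq_le)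
  finally show ?thesis .
qed

lemma stopping_time_event_observed:
  assumes "stopping_time (info M X Y L) T"
  shows "{\<omega>\<in>space M. T \<omega> \<le> enat n} \<in> sets (observed n)"
proof -
  have "Measurable.pred (observed n) (\<lambda>\<omega>. T \<omega> \<le> enat n)"
    using assms by (rule stopping_timeD)
  then show ?thesis by (simp add: pred_def space_info)
qed

lemma measurable_stopping_time_enat:
  assumes "stopping_time (info M X Y L) T"
  shows "T \<in> measurable M (count_space UNIV)"
proof -
  have le [measurable]: "{\<omega>\<in>space M. T \<omega> \<le> enat n} \<in> sets M" for n
    by (rule observed_in_events[OF stopping_time_event_observed[OF assms]])
  have "T -` {e} \<inter> space M \<in> sets M" for e
  proof (cases e)
    case (enat n)
    have "T -` {e} \<inter> space M = {\<omega>\<in>space M. T \<omega> \<le> enat n} - (\<Union>m<n. {\<omega>\<in>space M. T \<omega> \<le> enat m})"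
      unfolding enat
    proof (intro set_eqI iffI; clarsimp)
      fix \<omega> assume "\<omega> \<in> space M" "T \<omega> \<le> enat n" "\<forall>m\<in>{..<n}. \<not> T \<omega> \<le> enat m"
      then show "T \<omega> = enat n" by (cases "T \<omega>") (auto simp: le_less)
    qed
    then show ?thesis by simp
  next
    case infinity
    have "T -` {e} \<inter> space M = space M - (\<Union>n. {\<omega>\<in>space M. T \<omega> \<le> enat n})"
      unfolding infinity
    proof (intro set_eqI iffI; clarsimp)
      fix \<omega> assume "\<omega> \<in> space M" "\<forall>n. \<not> T \<omega> \<le> enat n"
      then show "T \<omega> = \<infinity>" by (cases "T \<omega>") auto
    qed
    then show ?thesis by simp
  qed
  then show ?thesis by (intro measurable_count_space_eq2_countable[THEN iffD2]) auto
qed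

lemma stopping_time_T_post: "stopping_time (info M X Y L) (T_post \<alpha>)"
  unfolding stopping_time_def
proof
  fix e :: enat
  show "Measurable.pred (info M X Y L e) (\<lambda>\<omega>. T_post \<alpha> \<omega> \<le> e)"
  proof (cases e)
    case (enat n)
    have [measurable]: "posterior m \<in> borel_measurable (observed n)" if "m \<in> {..n}" for m
      using that by (intro measurable_from_subalg[OF observed_mono measurable_posterior]) auto
    have "Measurable.pred (observed n) (\<lambda>\<omega>. \<exists>m\<in>{..n}. posterior m \<omega> \<le> \<alpha>)"
      by measurable
    then show ?thesis unfolding enat T_post_le_iff by (simp add: Bex_def)
  qed simp
qed

lemma emeasure_split_change_point:
  assumes "A \<in> sets M"
  shows "(\<Sum>k. emeasure M (change_in {k} \<inter> A)) = emeasure M A"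
proof -
  have "(\<Sum>k. emeasure M (change_in {k} \<inter> A)) = emeasure M (\<Union>k. change_in {k} \<inter> A)"
    using assms by (intro suminf_emeasure) (auto simp: disjoint_family_on_def)
  also have "(\<Union>k. change_in {k} \<inter> A) = A" using sets.sets_into_space[OF assms] by auto
  finally show ?thesis .
qed

text \<open>On \<open>T = n\<close> the conditional probability of \<open>t > n\<close> is at most \<open>\<alpha>\<close>, by the definition of the
  threshold time; \<open>T = \<infinity>\<close> is not a false alarm.\<close>

lemma PFA_T_post_le:
  assumes "\<alpha> > 0"
  shows "PFA M t (T_post \<alpha>) \<le> \<alpha>"
proof -
  note meas [measurable] = measurable_stopping_time_enat[OF stopping_time_T_post[of \<alpha>]]
  define A where "A n = {\<omega>\<in>space M. T_post \<alpha> \<omega> = enat n}" for n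
  have AM [measurable]: "A n \<in> sets M" for n unfolding A_def by measurable
  have AO: "A n \<in> sets (observed n)" for n
  proof -
    have "A n = {\<omega>\<in>space (observed n). T_post \<alpha> \<omega> \<le> enat n} - {\<omega>\<in>space (observed n). \<exists>m\<in>{..<n}. posterior m \<omega> \<le> \<alpha>}"
      unfolding A_def space_info
    proof (intro set_eqI iffI; clarsimp)
      fix \<omega> m assume "T_post \<alpha> \<omega> = enat n" "m < n" "posterior m \<omega> \<le> \<alpha>"
      then show False using T_post_le_iff[of \<alpha> \<omega> m] by auto
    next
      fix \<omega> assume "\<omega> \<in> space M" "T_post \<alpha> \<omega> \<le> enat n" "\<forall>m\<in>{..<n}. \<not> posterior m \<omega> \<le> \<alpha>"
      moreover have "\<not> T_post \<alpha> \<omega> < enat n"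
      proof
        assume "T_post \<alpha> \<omega> < enat n"
        then obtain k where "T_post \<alpha> \<omega> = enat k" "k < n" by (cases "T_post \<alpha> \<omega>") auto
        then obtain m where "m \<le> k" "posterior m \<omega> \<le> \<alpha>"
          using T_post_le_iff[of \<alpha> \<omega> k] by auto
        then show False using \<open>k < n\<close> \<open>\<forall>m\<in>{..<n}. \<not> posterior m \<omega> \<le> \<alpha>\<close> by auto
      qed
      ultimately show "T_post \<alpha> \<omega> = enat n" by simp
    qed
    moreover have "{\<omega>\<in>space (observed n). T_post \<alpha> \<omega> \<le> enat n} \<in> sets (observed n)"
      using stopping_time_event_observed[OF stopping_time_T_post] by (simp add: space_info)
    moreover have "{\<omega>\<in>space (observed n). \<exists>m\<in>{..<n}. posterior m \<omega> \<le> \<alpha>} \<in> sets (observed n)"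
    proof -
      have [measurable]: "posterior m \<in> borel_measurable (observed n)" if "m \<in> {..<n}" for m
        using that by (intro measurable_from_subalg[OF observed_mono measurable_posterior]) auto
      show ?thesis by measurable
    qed
    ultimately show ?thesis by auto
  qed
  have step: "emeasure M (A n \<inter> change_in {n<..}) \<le> ennreal \<alpha> * emeasure M (A n)" for n
  proof -
    interpret F: finite_measure_subalgebra M "observed n" by (rule finite_measure_subalgebra_observed)
    have int: "integrable M (\<lambda>\<omega>. indicator (A n) \<omega> * indicator (change_in {n<..}) \<omega> :: real)"
      by (auto simp: indicator_inter_arith[symmetric] emeasure_eq_measure intro!: integrable_real_indicator)
    have AI: "(indicator (A n) :: _ \<Rightarrow> real) \<in> borel_measurable (observed n)" using AO by measurable
    have i: "integrable M (\<lambda>\<omega>. indicator (A n) \<omega> * posterior n \<omega>)"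
      "(\<integral>\<omega>. indicator (A n) \<omega> * posterior n \<omega> \<partial>M) = (\<integral>\<omega>. indicator (A n) \<omega> * indicator (change_in {n<..}) \<omega> \<partial>M)"
      unfolding posterior_eq using F.real_cond_exp_intg[OF int AI] by auto
    have "prob (A n \<inter> change_in {n<..}) = (\<integral>\<omega>. indicator (A n) \<omega> * indicator (change_in {n<..}) \<omega> \<partial>M)"
      by (simp add: indicator_inter_arith[symmetric])
    also have "\<dots> = (\<integral>\<omega>. indicator (A n) \<omega> * posterior n \<omega> \<partial>M)" by (rule i(2)[symmetric])
    also have "\<dots> \<le> (\<integral>\<omega>. \<alpha> * indicator (A n) \<omega> \<partial>M)"
    proof (rule integral_mono[OF i(1)])
      show "integrable M (\<lambda>\<omega>. \<alpha> * indicator (A n) \<omega>)"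
        by (auto simp: emeasure_eq_measure intro!: integrable_mult_right integrable_real_indicator)
      fix \<omega>
      have "posterior n \<omega> \<le> \<alpha>" if T_eq: "T_post \<alpha> \<omega> = enat n"
      proof -
        obtain m where m: "m \<le> n" "posterior m \<omega> \<le> \<alpha>"
          using T_post_le_iff[of \<alpha> \<omega> n] T_eq by auto
        then have "T_post \<alpha> \<omega> \<le> enat m" using T_post_le_iff by blast
        then have "m = n" using T_eq m by simp
        then show ?thesis using m by simp
      qed
      then show "indicator (A n) \<omega> * posterior n \<omega> \<le> \<alpha> * indicator (A n) \<omega>"
        by (auto simp: A_def split: split_indicator)
    qed
    also have "\<dots> = \<alpha> * prob (A n)" by simp
    finally show ?thesis
      using assms by (simp add: emeasure_eq_measure ennreal_mult[symmetric])
  qed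
  have dis: "disjoint_family A" by (auto simp: disjoint_family_on_def A_def)
  have "{\<omega>\<in>space M. T_post \<alpha> \<omega> < enat (t \<omega>)} = (\<Union>n. A n \<inter> change_in {n<..})"
  proof (intro set_eqI iffI; clarsimp simp: A_def)
    fix \<omega> assume "T_post \<alpha> \<omega> < enat (t \<omega>)"
    then show "\<exists>n. T_post \<alpha> \<omega> = enat n \<and> n < t \<omega>" by (cases "T_post \<alpha> \<omega>") auto
  qed
  then have "emeasure M {\<omega>\<in>space M. T_post \<alpha> \<omega> < enat (t \<omega>)} = (\<Sum>n. emeasure M (A n \<inter> change_in {n<..}))"
    using dis by (simp only:, intro suminf_emeasure[symmetric]) (auto simp: disjoint_family_on_def)
  also have "\<dots> \<le> (\<Sum>n. ennreal \<alpha> * emeasure M (A n))"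
    by (intro suminf_le step) auto
  also have "\<dots> = ennreal \<alpha> * emeasure M (\<Union>n. A n)"
    using dis by (subst suminf_emeasure[symmetric]) auto
  also have "\<dots> \<le> ennreal \<alpha> * 1"
    by (intro mult_left_mono) (auto simp: emeasure_eq_measure)
  finally show ?thesis
    using assms by (simp add: PFA_def emeasure_eq_measure)
qed

lemma enat_less_diff_iff: "enat j < e - enat m \<longleftrightarrow> enat (m + j) < e"
  by (cases e) auto

lemma stopping_change_event:
  assumes "stopping_time (info M X Y L) T"
  shows "{\<omega>\<in>space M. P (T \<omega>) (t \<omega>)} \<in> sets M"
proof -
  have "{\<omega>\<in>space M. P (T \<omega>) (t \<omega>)} = (\<Union>k. change_in {k} \<inter> (T -` {e. P e k} \<inter> space M))" by auto
  also have "\<dots> \<in> sets M"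
    by (intro sets.countable_nat_UN image_subsetI sets.Int change_in_events
        measurable_sets[OF measurable_stopping_time_enat[OF assms]]) simp
  finally show ?thesis .
qed

lemma ADD_eq_suminf:
  assumes T: "stopping_time (info M X Y L) T"
  shows "ADD M t T = (\<Sum>j. emeasure M {\<omega>\<in>space M. enat (t \<omega> + j) < T \<omega>})"
proof -
  note [measurable] = measurable_stopping_time_enat[OF T]
  have "(\<lambda>\<omega>. T \<omega> - enat (t \<omega>)) \<in> measurable M (count_space UNIV)" by measurable
  then have "ADD M t T = (\<Sum>j. emeasure M {\<omega>\<in>space M. enat j < T \<omega> - enat (t \<omega>)})"
    unfolding ADD_def by (rule nn_integral_enat_function)
  then show ?thesis by (simp only: enat_less_diff_iff)
qed

section \<open>Delay of the posterior threshold time\<close>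

text \<open>No alarm by time \<open>k + j\<close> means that the posterior still exceeds \<open>\<alpha>\<close>, so \<open>posterior_LR_bound\<close> keeps
  \<open>LR k (k + j)\<close> below \<open>exp b\<close>. The resulting bound does not depend on \<open>k\<close> and can be
  averaged over the change point.\<close>

lemma delay_tail_T_post:
  fixes \<tau> \<alpha> :: real
  assumes lam: "0 \<le> \<tau>" "\<tau> * snr \<le> 1 / 2" and \<alpha>: "0 < \<alpha>"
  shows "emeasure M {\<omega>\<in>space M. enat (t \<omega> + j) < T_post \<alpha> \<omega>}
    \<le> ennreal (exp (\<tau> * (- ln \<alpha> - ln \<rho> + real (j + 1) * ln (1 - \<rho>))
        + real L * (real (j + 1) * tilt_bound (- \<tau>)) + 2 * real L * real Rmax))"
    (is "emeasure M ?E \<le> ennreal ?Q")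
proof -
  \<comment> \<open>\<open>exp b = P(t > k + j) / (\<alpha> P(t = k))\<close>, which does not depend on \<open>k\<close>\<close>
  define b where "b = - ln \<alpha> - ln \<rho> + real (j + 1) * ln (1 - \<rho>)"
  have E [measurable]: "?E \<in> sets M" by (rule stopping_change_event[OF stopping_time_T_post])
  have "emeasure M (change_in {k} \<inter> ?E) \<le> ennreal (prob (change_in {k})) * ennreal ?Q" for k
  proof -
    let ?n = "k + j"
    let ?p = "prob (change_in {k})"
    let ?B = "{\<omega>\<in>space M. 1 \<le> exp (\<tau> * b) * LR k ?n \<omega> powr (- \<tau>)}"
    have BM [measurable]: "?B \<in> sets M" by measurable
    have ratio: "prob (change_in {?n<..}) = \<alpha> * ?p * exp b"
      unfolding prob_change_eq prob_change_gt one_minus_rho_power b_def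
      using rho \<alpha> by (simp add: exp_add exp_diff exp_minus algebra_simps) (simp add: exp_add field_simps)
    have "AE \<omega> in M. \<omega> \<in> change_in {k} \<inter> ?E \<longrightarrow> \<omega> \<in> change_in {k} \<inter> ?B"
      using posterior_LR_bound[of k ?n] AE_space
    proof eventually_elim
      case (elim \<omega>)
      show ?case
      proof
        assume "\<omega> \<in> change_in {k} \<inter> ?E"
        then have tk: "t \<omega> = k" and "\<not> T_post \<alpha> \<omega> \<le> enat ?n" by auto
        then have post: "\<alpha> < posterior ?n \<omega>" unfolding T_post_le_iff by force
        have p: "0 < ?p" by (rule prob_change_pos)
        have "?p * LR k ?n \<omega> * \<alpha> \<le> ?p * LR k ?n \<omega> * posterior ?n \<omega>"
          using p LR_pos[of k ?n \<omega>] post by (intro mult_left_mono) auto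
        then have "?p * LR k ?n \<omega> * \<alpha> \<le> \<alpha> * ?p * exp b"
          using elim(1) unfolding ratio by linarith
        then have le: "LR k ?n \<omega> \<le> exp b" using p \<alpha> by simp
        have "exp b powr (- \<tau>) \<le> LR k ?n \<omega> powr (- \<tau>)"
          using le LR_pos[of k ?n \<omega>] lam by (intro powr_mono2') auto
        then have "exp (\<tau> * b) * exp b powr (- \<tau>) \<le> exp (\<tau> * b) * LR k ?n \<omega> powr (- \<tau>)"
          by (intro mult_left_mono) auto
        moreover have "exp (\<tau> * b) * exp b powr (- \<tau>) = 1"
          by (simp add: powr_def exp_add[symmetric])
        ultimately show "\<omega> \<in> change_in {k} \<inter> ?B" using elim tk by auto
      qed
    qed
    then have "emeasure M (change_in {k} \<inter> ?E) \<le> emeasure M (change_in {k} \<inter> ?B)"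
      by (rule emeasure_mono_AE) measurable
    also have "\<dots> = ennreal (?p * measure (given_change {k}) ?B)"
      using prob_change_pos(1)[of k]
      by (simp only: measure_given_change[OF prob_change_pos(1) BM] emeasure_eq_measure) simp
    also have "\<dots> \<le> ennreal (?p * ?Q)"
    proof (intro ennreal_leI mult_left_mono)
      show "measure (given_change {k}) ?B \<le> ?Q"
        using LR_chernoff[of "- \<tau>" k "\<tau> * b" j] lam by (simp add: b_def)
    qed simp
    finally show ?thesis by (simp add: ennreal_mult)
  qed
  then have "emeasure M ?E \<le> (\<Sum>k. ennreal (prob (change_in {k})) * ennreal ?Q)"
    unfolding emeasure_split_change_point[OF E, symmetric] by (intro suminf_le) auto
  also have "\<dots> = (\<Sum>k. emeasure M (change_in {k} \<inter> space M)) * ennreal ?Q"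
    by (simp add: emeasure_eq_measure Int_absorb2 Collect_restrict)
  also have "\<dots> = ennreal ?Q"
    by (subst emeasure_split_change_point) (auto simp: emeasure_space_1)
  finally show ?thesis .
qed

text \<open>Tail probabilities are bounded by 1 up to \<open>J \<approx> \<bar>ln \<alpha>\<bar> / D\<close>, where the exponent of \<open>delay_tail_T_post\<close>
  changes sign, and by a geometric series afterwards. \<open>D\<close> is the limiting rate up to a
  loss of order \<open>\<tau>\<close>; since \<open>\<tau>\<close> stays fixed as \<open>\<alpha>\<close> tends to 0, the remaining terms are constants.\<close>

lemma ADD_T_post_le:
  fixes \<tau> \<alpha> :: real
  assumes lam: "0 < \<tau>" "\<tau> * snr \<le> 1 / 2" and \<alpha>: "0 < \<alpha>" "\<alpha> < 1"
    and D: "D = total_rate - 3 * real L * snr\<^sup>2 * \<tau>" "D > 0"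
  shows "ADD M t (T_post \<alpha>)
    \<le> ennreal (- ln \<alpha> / D + 1 + exp (2 * real L * real Rmax - \<tau> * ln \<rho>) / (1 - exp (- \<tau> * D)))"
proof -
  define B where "B = exp (2 * real L * real Rmax - \<tau> * ln \<rho>)"
  define q where "q = exp (- \<tau> * D)"
  define J where "J = nat \<lceil>- ln \<alpha> / D\<rceil>"
  have q: "0 < q" "q < 1" using lam D by (auto simp: q_def)
  have J: "- ln \<alpha> / D \<le> real J" "real J \<le> - ln \<alpha> / D + 1"
  proof -
    have "0 \<le> - ln \<alpha> / D" using \<alpha> D by (intro divide_nonneg_pos) auto
    then show "- ln \<alpha> / D \<le> real J" "real J \<le> - ln \<alpha> / D + 1" unfolding J_def by linarith+
  qed
  define f where "f j = (if j < J then 1 else B * q ^ (j - J))" for j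
  have tail: "emeasure M {\<omega>\<in>space M. enat (t \<omega> + j) < T_post \<alpha> \<omega>} \<le> ennreal (f j)" for j
  proof (cases "j < J")
    case True
    then show ?thesis by (simp add: f_def emeasure_eq_measure)
  next
    case False
    have "\<tau> * (- ln \<alpha> - ln \<rho> + real (j + 1) * ln (1 - \<rho>))
        + real L * (real (j + 1) * tilt_bound (- \<tau>)) + 2 * real L * real Rmax
      = (2 * real L * real Rmax - \<tau> * ln \<rho>) + \<tau> * (- ln \<alpha> - real (j + 1) * D)"
      by (simp add: tilt_bound_def D total_rate_def abs_ln_rho power2_eq_square algebra_simps)
    also have "- ln \<alpha> \<le> real J * D" using J(1) by (simp only: pos_divide_le_eq[OF D(2)])
    then have "- ln \<alpha> - real (j + 1) * D \<le> real J * D - real j * D"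
      using D(2) by (simp add: distrib_right)
    then have "(2 * real L * real Rmax - \<tau> * ln \<rho>) + \<tau> * (- ln \<alpha> - real (j + 1) * D)
      \<le> (2 * real L * real Rmax - \<tau> * ln \<rho>) + \<tau> * (real J * D - real j * D)"
      using lam by (intro add_left_mono mult_left_mono) auto
    also have "\<dots> = (2 * real L * real Rmax - \<tau> * ln \<rho>) + real (j - J) * (- \<tau> * D)"
      using False by (simp add: of_nat_diff algebra_simps)
    finally have "exp (\<tau> * (- ln \<alpha> - ln \<rho> + real (j + 1) * ln (1 - \<rho>))
        + real L * (real (j + 1) * tilt_bound (- \<tau>)) + 2 * real L * real Rmax)
      \<le> exp ((2 * real L * real Rmax - \<tau> * ln \<rho>) + real (j - J) * (- \<tau> * D))" by simp
    also have "\<dots> = f j" using False unfolding f_def B_def q_def exp_of_nat_mult[symmetric] exp_add by simp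
    finally show ?thesis
      using delay_tail_T_post[OF _ lam(2) \<alpha>(1), of j] lam(1)
      by (meson ennreal_leI less_imp_le order_trans)
  qed
  have "(\<lambda>i. B * q ^ i) sums (B * (1 / (1 - q)))"
    using q by (intro sums_mult geometric_sums) auto
  then have "(\<lambda>i. f (i + J)) sums (B / (1 - q))" by (simp add: f_def)
  then have "f sums (B / (1 - q) + (\<Sum>i<J. f i))" by (simp only: sums_iff_shift)
  then have sums: "f sums (B / (1 - q) + real J)" by (simp add: f_def)
  have "ADD M t (T_post \<alpha>) \<le> (\<Sum>j. ennreal (f j))"
    unfolding ADD_eq_suminf[OF stopping_time_T_post] by (intro suminf_le tail) auto
  also have "\<dots> = ennreal (B / (1 - q) + real J)"
    by (rule suminf_ennreal_eq[OF _ sums]) (use q in \<open>auto simp: f_def B_def\<close>)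
  also have "\<dots> \<le> ennreal (- ln \<alpha> / D + 1 + B / (1 - q))"
    using J(2) by (intro ennreal_leI) simp
  finally show ?thesis unfolding B_def q_def .
qed

section \<open>Delay of an arbitrary stopping time\<close>

text \<open>\<open>{T \<le> k + K}\<close> is observable at time \<open>k + K\<close>, so its probability given \<open>t = k\<close> is an integral of \<open>LR\<close>
  over the no-change law. Where \<open>LR \<le> exp c\<close> it is at most \<open>exp c\<close> times the no-change probability of
  the event, and \<open>T \<le> k + K < t\<close> is a false alarm.\<close>

lemma early_stop_bound:
  fixes \<tau> \<alpha> c :: real
  assumes T: "stopping_time (info M X Y L) T" and pfa: "PFA M t T \<le> \<alpha>"
    and lam: "0 \<le> \<tau>" "\<tau> * snr \<le> 1 / 2"
  shows "measure (given_change {k}) {\<omega>\<in>space M. T \<omega> \<le> enat (k + K)}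
    \<le> exp c * \<alpha> / (1 - \<rho>) ^ (k + K + 1)
      + exp (- \<tau> * c + real L * (real (K + 1) * tilt_bound \<tau>) + 2 * real L * real Rmax)"
proof -
  let ?n = "k + K"
  interpret G: prob_space "given_change {k}" by (rule prob_space_given_change) (rule prob_change_pos)
  interpret H: prob_space "given_change {?n<..}" by (rule prob_space_given_change) (rule prob_change_pos)
  note [measurable] = measurable_stopping_time_enat[OF T]
  define A where "A = {\<omega>\<in>space M. T \<omega> \<le> enat ?n}"
  define V where "V = {\<omega>\<in>space (observed ?n). exp c < LR k ?n \<omega>}"
  have AO: "A \<in> sets (observed ?n)" unfolding A_def by (rule stopping_time_event_observed[OF T])
  have VO: "V \<in> sets (observed ?n)"
    unfolding V_def using measurable_LR_observed[of k ?n] by measurable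
  have [measurable]: "A \<in> sets M" "V \<in> sets M" using AO VO by (auto intro: observed_in_events)
  have "emeasure (given_change {k}) A = (\<integral>\<^sup>+ \<omega>. ennreal (LR k ?n \<omega>) * indicator A \<omega> \<partial>given_change {?n<..})"
    by (rule change_of_measure[OF AO])
  also have "\<dots> \<le> (\<integral>\<^sup>+ \<omega>. ennreal (exp c) * indicator A \<omega> + ennreal (LR k ?n \<omega>) * indicator V \<omega> \<partial>given_change {?n<..})"
    by (intro nn_integral_mono)
      (auto simp: V_def space_info not_less intro!: ennreal_leI split: split_indicator)
  also have "\<dots> = ennreal (exp c) * emeasure (given_change {?n<..}) A
      + (\<integral>\<^sup>+ \<omega>. ennreal (LR k ?n \<omega>) * indicator V \<omega> \<partial>given_change {?n<..})"
    by (subst nn_integral_add) (auto simp: nn_integral_cmult)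
  also have "\<dots> = ennreal (exp c * measure (given_change {?n<..}) A + measure (given_change {k}) V)"
    unfolding change_of_measure[OF VO, symmetric] G.emeasure_eq_measure H.emeasure_eq_measure
    by (simp add: ennreal_mult ennreal_plus)
  finally have 1: "measure (given_change {k}) A \<le> exp c * measure (given_change {?n<..}) A + measure (given_change {k}) V"
    by (subst (asm) G.emeasure_eq_measure, subst (asm) ennreal_le_iff) auto
  have "prob (change_in {?n<..} \<inter> A) \<le> PFA M t T"
    unfolding PFA_def
  proof (rule finite_measure_mono)
    show "change_in {?n<..} \<inter> A \<subseteq> {\<omega>\<in>space M. T \<omega> < enat (t \<omega>)}"
      by (auto simp: A_def elim: order.strict_trans1)
  qed (rule stopping_change_event[OF T])
  also note pfa
  finally have 2: "measure (given_change {?n<..}) A \<le> \<alpha> / (1 - \<rho>) ^ (?n + 1)"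
    using rho by (simp only: measure_given_change[OF prob_change_pos(2) \<open>A \<in> sets M\<close>] prob_change_gt)
      (intro divide_right_mono; simp)
  have "V \<subseteq> {\<omega>\<in>space M. 1 \<le> exp (- \<tau> * c) * LR k ?n \<omega> powr \<tau>}"
  proof
    fix \<omega> assume "\<omega> \<in> V"
    then have \<omega>: "\<omega> \<in> space M" "exp c \<le> LR k ?n \<omega>" by (auto simp: V_def space_info)
    have "exp c powr \<tau> \<le> LR k ?n \<omega> powr \<tau>" using \<omega>(2) lam by (intro powr_mono2) auto
    then have "exp (- \<tau> * c) * exp c powr \<tau> \<le> exp (- \<tau> * c) * LR k ?n \<omega> powr \<tau>"
      by (intro mult_left_mono) auto
    moreover have "exp (- \<tau> * c) * exp c powr \<tau> = 1"
      by (simp add: powr_def exp_add[symmetric])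
    ultimately have "1 \<le> exp (- \<tau> * c) * LR k ?n \<omega> powr \<tau>" by linarith
    then show "\<omega> \<in> {\<omega>\<in>space M. 1 \<le> exp (- \<tau> * c) * LR k ?n \<omega> powr \<tau>}" using \<omega>(1) by simp
  qed
  then have "measure (given_change {k}) V
      \<le> measure (given_change {k}) {\<omega>\<in>space M. 1 \<le> exp (- \<tau> * c) * LR k ?n \<omega> powr \<tau>}"
    by (rule G.finite_measure_mono) measurable
  also have "\<dots> \<le> exp (- \<tau> * c + real L * (real (K + 1) * tilt_bound \<tau>) + 2 * real L * real Rmax)"
    by (rule LR_chernoff) (use lam in simp)
  finally have 3: "measure (given_change {k}) V
      \<le> exp (- \<tau> * c + real L * (real (K + 1) * tilt_bound \<tau>) + 2 * real L * real Rmax)" .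
  have "exp c * measure (given_change {?n<..}) A \<le> exp c * (\<alpha> / (1 - \<rho>) ^ (?n + 1))"
    using 2 by (intro mult_left_mono) auto
  with 1 3 show ?thesis unfolding A_def by simp
qed

text \<open>The factor \<open>(1 - \<rho>) ^ (k + K + 1)\<close> in \<open>early_stop_bound\<close> is not summable against the prior, hence the
  cut-off \<open>N\<close>: later change points are bounded by their prior probability, which does not depend on
  \<open>\<alpha>\<close>.\<close>

lemma ADD_ge:
  fixes \<tau> \<alpha> c :: real
  assumes T: "stopping_time (info M X Y L) T" and pfa: "PFA M t T \<le> \<alpha>"
    and lam: "0 \<le> \<tau>" "\<tau> * snr \<le> 1 / 2"
  shows "ADD M t T \<ge> ennreal (real (K + 1) * (1 - ((1 - \<rho>) ^ (N + 1)
    + exp c * \<alpha> / (1 - \<rho>) ^ (N + K + 1)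
    + exp (- \<tau> * c + real L * (real (K + 1) * tilt_bound \<tau>) + 2 * real L * real Rmax))))"
proof -
  note [measurable] = measurable_stopping_time_enat[OF T]
  define \<epsilon> where "\<epsilon> = exp c * \<alpha> / (1 - \<rho>) ^ (N + K + 1)
    + exp (- \<tau> * c + real L * (real (K + 1) * tilt_bound \<tau>) + 2 * real L * real Rmax)"
  have \<alpha>0: "0 \<le> \<alpha>" using pfa[unfolded PFA_def] by (rule order_trans[OF measure_nonneg])
  define W where "W = {\<omega>\<in>space M. T \<omega> \<le> enat (t \<omega> + K)}"
  have WM [measurable]: "W \<in> sets M" unfolding W_def by (rule stopping_change_event[OF T])
  have k: "prob (change_in {k} \<inter> W) \<le> prob (change_in {k}) * \<epsilon>" if "k \<le> N" for k
  proof -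
    have AM: "{\<omega>\<in>space M. T \<omega> \<le> enat (k + K)} \<in> sets M" by measurable
    have "change_in {k} \<inter> W = change_in {k} \<inter> {\<omega>\<in>space M. T \<omega> \<le> enat (k + K)}"
      by (auto simp: W_def)
    then have "prob (change_in {k} \<inter> W) = prob (change_in {k}) * measure (given_change {k}) {\<omega>\<in>space M. T \<omega> \<le> enat (k + K)}"
      using prob_change_pos(1)[of k]
      by (simp only: measure_given_change[OF prob_change_pos(1) AM]) simp
    also have "\<dots> \<le> prob (change_in {k}) * \<epsilon>"
    proof (rule mult_left_mono)
      have "(1 - \<rho>) ^ (N + K + 1) \<le> (1 - \<rho>) ^ (k + K + 1)"
        using rho that by (intro power_decreasing) auto
      then have "exp c * \<alpha> / (1 - \<rho>) ^ (k + K + 1) \<le> exp c * \<alpha> / (1 - \<rho>) ^ (N + K + 1)"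
        using rho \<alpha>0 by (intro divide_left_mono) auto
      then show "measure (given_change {k}) {\<omega>\<in>space M. T \<omega> \<le> enat (k + K)} \<le> \<epsilon>"
        using early_stop_bound[OF T pfa lam, of k K c] unfolding \<epsilon>_def by linarith
    qed simp
    finally show ?thesis .
  qed
  have \<epsilon>0: "0 \<le> \<epsilon>" using \<alpha>0 rho by (simp add: \<epsilon>_def)
  have "W \<subseteq> change_in {N<..} \<union> (\<Union>k\<le>N. change_in {k} \<inter> W)"
    using sets.sets_into_space[OF WM] by auto
  then have "prob W \<le> prob (change_in {N<..} \<union> (\<Union>k\<le>N. change_in {k} \<inter> W))"
    by (rule finite_measure_mono) auto
  also have "\<dots> \<le> prob (change_in {N<..}) + prob (\<Union>k\<le>N. change_in {k} \<inter> W)"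
    by (rule measure_Un_le) auto
  also have "prob (\<Union>k\<le>N. change_in {k} \<inter> W) \<le> (\<Sum>k\<le>N. prob (change_in {k} \<inter> W))"
    by (rule measure_UNION_le) auto
  also have "\<dots> \<le> (\<Sum>k\<le>N. prob (change_in {k}) * \<epsilon>)" by (intro sum_mono k) auto
  also have "\<dots> = (\<Sum>k\<le>N. prob (change_in {k})) * \<epsilon>" by (rule sum_distrib_right[symmetric])
  also have "(\<Sum>k\<le>N. prob (change_in {k})) = prob (\<Union>k\<le>N. change_in {k})"
    by (rule finite_measure_finite_Union[symmetric]) (auto simp: disjoint_family_on_def)
  also have "\<dots> * \<epsilon> \<le> 1 * \<epsilon>" by (rule mult_right_mono[OF prob_le_1 \<epsilon>0])
  finally have "prob W \<le> prob (change_in {N<..}) + \<epsilon>" by simp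
  then have W: "prob W \<le> (1 - \<rho>) ^ (N + 1) + \<epsilon>" by (simp only: prob_change_gt)
  have "ennreal (real (K + 1) * (1 - ((1 - \<rho>) ^ (N + 1) + \<epsilon>))) \<le> ennreal (real (K + 1) * prob (space M - W))"
    using W by (intro ennreal_leI mult_left_mono) (auto simp: prob_compl)
  also have "\<dots> = (\<integral>\<^sup>+ \<omega>. ennreal (real (K + 1)) * indicator (space M - W) \<omega> \<partial>M)"
    by (subst nn_integral_cmult) (auto simp: emeasure_eq_measure ennreal_mult)
  also have "\<dots> \<le> ADD M t T"
    unfolding ADD_def
  proof (intro nn_integral_mono)
    fix \<omega> assume "\<omega> \<in> space M"
    show "ennreal (real (K + 1)) * indicator (space M - W) \<omega> \<le> ennreal_of_enat (T \<omega> - enat (t \<omega>))"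
    proof (cases "\<omega> \<in> W")
      case False
      with \<open>\<omega> \<in> space M\<close> have "enat (t \<omega> + K) < T \<omega>" by (simp add: W_def)
      then have "enat (K + 1) \<le> T \<omega> - enat (t \<omega>)" by (cases "T \<omega>") auto
      then have "ennreal_of_enat (enat (K + 1)) \<le> ennreal_of_enat (T \<omega> - enat (t \<omega>))"
        by (simp only: ennreal_of_enat_le_iff)
      moreover have "ennreal_of_enat (enat (K + 1)) = ennreal (real (K + 1))"
        by (simp only: ennreal_of_enat_enat ennreal_of_nat_eq_real_of_nat)
      ultimately show ?thesis using False \<open>\<omega> \<in> space M\<close> by simp
    qed simp
  qed
  finally show ?thesis unfolding \<epsilon>_def by (simp add: add.assoc)
qed

section \<open>Information rate in free space\<close>

lemma emeasure_disk_eq: "0 \<le> r \<Longrightarrow> emeasure lborel (cball src r) = ennreal (pi * r\<^sup>2)"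
  by (subst emeasure_cball) (auto simp: unit_ball_vol_2)

text \<open>The area of a disk is proportional to its squared radius, so both laws have the same distribution
  function. This replaces polar coordinates.\<close>

lemma distr_sq_dist_location_law:
  "distr location_law borel (\<lambda>x. (dist x src)\<^sup>2) = uniform_measure lborel {0..R\<^sup>2}" (is "?A = ?B")
proof -
  interpret U: prob_space location_law by (rule prob_space_location_law)
  have R2: "0 < R\<^sup>2" using R_ge_1 by simp
  have mS: "(\<lambda>x. (dist x src)\<^sup>2) \<in> borel_measurable location_law" by measurable
  interpret A: prob_space ?A by (rule U.prob_space_distr[OF mS])
  interpret B: prob_space ?B
    by (rule prob_space_uniform_measure) (use R2 in auto)
  have eq: "emeasure ?A {..x} = emeasure ?B {..x}" for x
  proof -
    have A: "emeasure ?A {..x} = emeasure lborel (cball src R \<inter> {y. (dist y src)\<^sup>2 \<le> x}) / ennreal (pi * R\<^sup>2)"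
    proof -
      have "emeasure ?A {..x} = emeasure location_law {y. (dist y src)\<^sup>2 \<le> x}"
        by (subst emeasure_distr[OF mS]) (auto intro!: arg_cong2[where f=emeasure])
      also have "\<dots> = emeasure lborel (cball src R \<inter> {y. (dist y src)\<^sup>2 \<le> x}) / emeasure lborel (cball src R)"
        unfolding location_law_def by (rule emeasure_uniform_measure) (auto, measurable)
      finally show ?thesis using R_ge_1 by (simp add: emeasure_disk_eq)
    qed
    have B: "emeasure ?B {..x} = emeasure lborel {0..min x (R\<^sup>2)} / ennreal (R\<^sup>2)"
    proof -
      have "{0..R\<^sup>2} \<inter> {..x} = {0..min x (R\<^sup>2)}" by auto
      then show ?thesis by (subst emeasure_uniform_measure) auto
    qed
    show ?thesis
    proof (cases "0 \<le> x")
      case False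
      then have "{y. (dist y src)\<^sup>2 \<le> x} = {}" "{0..min x (R\<^sup>2)} = {}"
        using zero_le_power2 order_trans by (blast, auto)
      then show ?thesis unfolding A B by simp
    next
      case True
      define m where "m = min x (R\<^sup>2)"
      have m: "0 \<le> m" using True by (simp add: m_def)
      have "cball src R \<inter> {y. (dist y src)\<^sup>2 \<le> x} = cball src (sqrt m)"
      proof (rule set_eqI)
        fix y
        have "dist src y \<le> R \<longleftrightarrow> (dist src y)\<^sup>2 \<le> R\<^sup>2"
          using R_ge_1 abs_le_square_iff[of "dist src y" R] by simp
        moreover have "dist src y \<le> sqrt m \<longleftrightarrow> (dist src y)\<^sup>2 \<le> m"
          using m by (metis real_le_rsqrt real_sqrt_le_iff real_sqrt_abs abs_of_nonneg zero_le_dist)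
        ultimately show "y \<in> cball src R \<inter> {y. (dist y src)\<^sup>2 \<le> x} \<longleftrightarrow> y \<in> cball src (sqrt m)"
          by (auto simp: m_def dist_commute)
      qed
      then have "emeasure ?A {..x} = ennreal (pi * m) / ennreal (pi * R\<^sup>2)"
        unfolding A using m by (simp add: emeasure_disk_eq)
      also have "\<dots> = ennreal m / ennreal (R\<^sup>2)"
        using m R2 by (simp add: divide_ennreal)
      finally show ?thesis unfolding B m_def[symmetric] using m by simp
    qed
  qed
  show ?thesis
  proof (rule cdf_unique')
    show "finite_borel_measure ?A" "finite_borel_measure ?B"
      by (intro finite_borel_measure.intro finite_borel_measure_axioms.intro
          A.finite_measure_axioms B.finite_measure_axioms; simp)+
    show "cdf ?A = cdf ?B"
      unfolding cdf_def measure_def eq ..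
  qed
qed

lemma has_integral_free_space_kl:
  "((\<lambda>s. gauss_kl (1 + snr / max s 1)) has_integral R\<^sup>2 * q_free_space R snr) {0..R\<^sup>2}"
proof -
  have R2: "1 \<le> R\<^sup>2" using R_ge_1 by (simp add: one_le_power)
  \<comment> \<open>an antiderivative of \<open>gauss_kl (1 + snr / s)\<close>\<close>
  define F where "F s = (snr * ln s - (s + snr) * ln (s + snr) + s * ln s) / 2" for s
  have 1: "((\<lambda>s. gauss_kl (1 + snr / max s 1)) has_integral gauss_kl (1 + snr)) {0..1}"
  proof -
    have "((\<lambda>s. gauss_kl (1 + snr)) has_integral gauss_kl (1 + snr)) {0..1::real}"
      using has_integral_const_real[of "gauss_kl (1 + snr)" 0 1] by simp
    then show ?thesis by (rule has_integral_eq[rotated]) (auto simp: max_def)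
  qed
  have 2: "((\<lambda>s. gauss_kl (1 + snr / max s 1)) has_integral (F (R\<^sup>2) - F 1)) {1..R\<^sup>2}"
  proof (rule fundamental_theorem_of_calculus[OF R2])
    fix s assume s: "s \<in> {1..R\<^sup>2}"
    then have s0: "0 < s" "0 < s + snr" using snr_pos by auto
    have "1 + snr / s = (s + snr) / s" using s0 by (simp add: field_simps)
    then have ln: "ln (1 + snr / s) = ln (s + snr) - ln s" using s0 by (simp add: ln_div)
    have mx: "max s 1 = s" using s by simp
    have "(F has_real_derivative gauss_kl (1 + snr / max s 1)) (at s)"
      unfolding F_def mx
      by (rule derivative_eq_intros refl s0 | simp)+
        (use s s0 in \<open>simp add: gauss_kl_def ln diff_divide_distrib add_divide_distrib\<close>)
    then show "(F has_vector_derivative gauss_kl (1 + snr / max s 1)) (at s within {1..R\<^sup>2})"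
      by (simp add: has_real_derivative_iff_has_vector_derivative has_vector_derivative_at_within)
  qed
  have "((\<lambda>s. gauss_kl (1 + snr / max s 1)) has_integral (gauss_kl (1 + snr) + (F (R\<^sup>2) - F 1))) {0..R\<^sup>2}"
    by (rule has_integral_combine[OF _ R2 1 2]) simp
  also have "gauss_kl (1 + snr) + (F (R\<^sup>2) - F 1) = R\<^sup>2 * q_free_space R snr"
  proof -
    have "R\<^sup>2 \<noteq> 0" using R2 by linarith
    then have "1 + snr / R\<^sup>2 = (R\<^sup>2 + snr) / R\<^sup>2" by (simp add: add_divide_distrib)
    then have "ln (1 + snr / R\<^sup>2) = ln (R\<^sup>2 + snr) - ln (R\<^sup>2)"
      using ln_divide_pos[of "R\<^sup>2 + snr" "R\<^sup>2"] R2 snr_pos R_ge_1 by simp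
    moreover have "R\<^sup>2 * (1 / (2 * R\<^sup>2) * x) = x / 2" for x using R_ge_1 by simp
    ultimately have "R\<^sup>2 * q_free_space R snr
        = (snr + snr * ln (snr + 1) - (snr + R\<^sup>2) * (ln (R\<^sup>2 + snr) - ln (R\<^sup>2))) / 2"
      unfolding q_free_space_def by simp
    then show ?thesis
      unfolding F_def gauss_kl_def
      by (simp add: algebra_simps diff_divide_distrib add_divide_distrib del: ln_realpow)
  qed
  finally show ?thesis .
qed

text \<open>A sensor in the disk is strictly within the fully grown event unless it lies on the boundary circle,
  a null set that matters only if \<open>R = u Rmax\<close>.\<close>

lemma kl_rate_free_space:
  assumes "\<theta> = 2"
  shows "kl_rate = q_free_space R snr"
proof -
  let ?h = "\<lambda>s. gauss_kl (1 + snr / max s 1)"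
  have R2: "1 \<le> R\<^sup>2" using R_ge_1 by (simp add: one_le_power)
  have mS: "(\<lambda>x. (dist x src)\<^sup>2) \<in> borel_measurable location_law" by measurable
  have mh [measurable]: "?h \<in> borel_measurable borel" unfolding gauss_kl_def by measurable
  have h0: "0 \<le> ?h s" for s
    using snr_pos by (intro gauss_kl_bounds) auto
  have "AE s in uniform_measure lborel {0..R\<^sup>2}. s < R\<^sup>2"
    by (rule AE_uniform_measureI) (use AE_lborel_singleton[of "R\<^sup>2"] in auto)
  then have "AE x in location_law. (dist x src)\<^sup>2 < R\<^sup>2"
    unfolding distr_sq_dist_location_law[symmetric] by (rule AE_distrD[OF mS])
  then have ae: "AE x in location_law. gauss_kl (variance_ratio Rmax x) = ?h ((dist x src)\<^sup>2)"
  proof eventually_elim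
    case (elim x)
    then have "dist x src < R" using R_ge_1 by (simp add: power_less_imp_less_base)
    then have "dist x src < u * real Rmax" using Rmax_covers by simp
    moreover have "max (dist x src) 1 powr \<theta> = max ((dist x src)\<^sup>2) 1"
      by (auto simp: assms max_def powr_numeral abs_square_le_1 intro!: antisym)
    ultimately show ?case by (simp add: variance_ratio_def)
  qed
  have "ennreal kl_rate = (\<integral>\<^sup>+ x. ennreal (gauss_kl (variance_ratio Rmax x)) \<partial>location_law)"
    unfolding kl_rate_def
    by (rule nn_integral_eq_integral[OF integrable_gauss_kl, symmetric]) (auto simp: gauss_kl_variance_ratio)
  also have "\<dots> = (\<integral>\<^sup>+ x. ennreal (?h ((dist x src)\<^sup>2)) \<partial>location_law)"
    using ae by (intro nn_integral_cong_AE) auto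
  also have "\<dots> = (\<integral>\<^sup>+ s. ennreal (?h s) \<partial>uniform_measure lborel {0..R\<^sup>2})"
    unfolding distr_sq_dist_location_law[symmetric] by (rule nn_integral_distr[symmetric, OF mS]) measurable
  also have "\<dots> = (\<integral>\<^sup>+ s. ennreal (?h s) * indicator {0..R\<^sup>2} s \<partial>lborel) / emeasure lborel {0..R\<^sup>2}"
    by (rule nn_integral_uniform_measure) measurable
  also have "(\<integral>\<^sup>+ s. ennreal (?h s) * indicator {0..R\<^sup>2} s \<partial>lborel)
      = (\<integral>\<^sup>+ s. ennreal (if s \<in> {0..R\<^sup>2} then ?h s else 0) \<partial>lborel)"
    by (intro nn_integral_cong) (auto split: split_indicator)
  also have "\<dots> = ennreal (R\<^sup>2 * q_free_space R snr)"
  proof (rule nn_integral_has_integral_lborel)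
    show "((\<lambda>s. if s \<in> {0..R\<^sup>2} then ?h s else 0) has_integral R\<^sup>2 * q_free_space R snr) UNIV"
      using has_integral_free_space_kl by (simp only: has_integral_restrict_UNIV)
  qed (use h0 in auto)
  finally have k: "ennreal kl_rate = ennreal (R\<^sup>2 * q_free_space R snr) / ennreal (R\<^sup>2)" by simp
  have I0: "0 \<le> R\<^sup>2 * q_free_space R snr"
    by (rule has_integral_nonneg[OF has_integral_free_space_kl]) (use h0 in auto)
  then have "ennreal kl_rate = ennreal (R\<^sup>2 * q_free_space R snr / R\<^sup>2)"
    unfolding k using R2 by (intro divide_ennreal) auto
  moreover have "0 \<le> R\<^sup>2 * q_free_space R snr / R\<^sup>2" using I0 by (intro divide_nonneg_nonneg) auto
  ultimately have "kl_rate = R\<^sup>2 * q_free_space R snr / R\<^sup>2"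
    using kl_rate_bounds(1) by (simp only: ennreal_inj)
  moreover have "R \<noteq> 0" using R_ge_1 by simp
  ultimately show ?thesis by simp
qed

section \<open>First-order asymptotics\<close>

text \<open>The exponent \<open>\<tau>\<close> of \<open>ADD_T_post_le\<close> is chosen first, so small that the loss in the rate is covered by
  half of \<open>\<eta>\<close>; the other half absorbs the constant terms as \<open>\<alpha>\<close> tends to 0.\<close>

lemma ADD_T_post_asymptotic_upper:
  assumes "\<eta> > 0"
  shows "\<forall>\<^sub>F \<alpha> in at_right 0. ADD M t (T_post \<alpha>) \<le> ennreal ((1 + \<eta>) * (- ln \<alpha> / total_rate))"
proof -
  define V where "V = 3 * real L * snr\<^sup>2"
  have V: "0 < V" using L_pos snr_pos by (simp add: V_def)
  define \<delta> where "\<delta> = total_rate - total_rate / (1 + \<eta> / 2)"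
  have \<delta>: "0 < \<delta>"
    using total_rate_pos assms by (simp add: \<delta>_def field_simps)
  define \<tau> where "\<tau> = min (1 / (2 * snr)) (\<delta> / V)"
  have \<tau>: "0 < \<tau>" "\<tau> * snr \<le> 1 / 2" "V * \<tau> \<le> \<delta>"
  proof -
    show "0 < \<tau>" using snr_pos V \<delta> by (simp add: \<tau>_def)
    have "\<tau> * snr \<le> 1 / (2 * snr) * snr" using snr_pos by (intro mult_right_mono) (auto simp: \<tau>_def)
    then show "\<tau> * snr \<le> 1 / 2" using snr_pos by simp
    have "V * \<tau> \<le> V * (\<delta> / V)" using V by (intro mult_left_mono) (auto simp: \<tau>_def)
    then show "V * \<tau> \<le> \<delta>" using V by simp
  qed
  define D where "D = total_rate - V * \<tau>"
  have D: "total_rate / (1 + \<eta> / 2) \<le> D" using \<tau>(3) by (simp add: D_def \<delta>_def)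
  moreover have D1: "0 < total_rate / (1 + \<eta> / 2)" using total_rate_pos assms by simp
  ultimately have D0: "0 < D" by linarith
  define B where "B = 1 + exp (2 * real L * real Rmax - \<tau> * ln \<rho>) / (1 - exp (- \<tau> * D))"
  have "\<forall>\<^sub>F l in at_top. B \<le> \<eta> / 2 * (l / total_rate)"
  proof (rule eventually_at_top_linorderI)
    fix l assume "B / (\<eta> / 2) * total_rate \<le> l"
    then have "B / (\<eta> / 2) \<le> l / total_rate" using total_rate_pos by (simp only: pos_le_divide_eq)
    then show "B \<le> \<eta> / 2 * (l / total_rate)" using assms by (simp add: field_simps)
  qed
  from eventually_neg_ln_at_right_0[OF this] show ?thesis
  proof eventually_elim
    case (elim \<alpha>)
    have "- ln \<alpha> / D \<le> - ln \<alpha> / (total_rate / (1 + \<eta> / 2))"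
      using elim D D0 D1 by (intro divide_left_mono mult_pos_pos) auto
    also have "\<dots> = (1 + \<eta> / 2) * (- ln \<alpha> / total_rate)" by simp
    finally have "- ln \<alpha> / D + B \<le> (1 + \<eta>) * (- ln \<alpha> / total_rate)"
      using elim distrib_right[of "1 + \<eta> / 2" "\<eta> / 2" "- ln \<alpha> / total_rate"]
      by (simp only: add.assoc field_sum_of_halves) linarith
    moreover have "ADD M t (T_post \<alpha>) \<le> ennreal (- ln \<alpha> / D + B)"
      unfolding B_def add.assoc[symmetric]
      by (rule ADD_T_post_le) (use \<tau> elim D0 in \<open>auto simp: D_def V_def\<close>)
    ultimately show ?case by (meson ennreal_leI order_trans)
  qed
qed

text \<open>In \<open>ADD_ge\<close>, \<open>N\<close> and \<open>\<tau>\<close> are fixed and \<open>K\<close> is about \<open>(1 - \<eta> / 2) \<bar>ln \<alpha>\<bar> / D\<close>. With \<open>c\<close> exceeding the mean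
  \<open>K L q\<close> by a fraction of \<open>K\<close>, both \<open>exp c \<alpha> / (1 - \<rho>) ^ K\<close> and the Chernoff term vanish; the former
  because \<open>(1 + \<eta> / 2) (1 - \<eta> / 2) < 1\<close>.\<close>

lemma ADD_asymptotic_lower:
  assumes \<eta>: "0 < \<eta>" "\<eta> < 1"
  shows "\<forall>\<^sub>F \<alpha> in at_right 0. \<forall>T. stopping_time (info M X Y L) T \<longrightarrow> PFA M t T \<le> \<alpha> \<longrightarrow>
    ennreal ((1 - \<eta>) * (- ln \<alpha> / total_rate)) \<le> ADD M t T"
proof -
  let ?D = total_rate
  define a where "a = - ln (1 - \<rho>)"
  have a: "0 < a" "?D = real L * kl_rate + a" using abs_ln_rho by (auto simp: a_def total_rate_def)
  define V where "V = 3 * real L * snr\<^sup>2"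
  have V: "0 < V" using L_pos snr_pos by (simp add: V_def)
  define \<delta> where "\<delta> = ?D * \<eta> / 2"
  have \<delta>: "0 < \<delta>" using total_rate_pos \<eta> by (simp add: \<delta>_def)
  \<comment> \<open>the first bound is the range of the moment estimate; by the second, the quadratic error\<close>
  \<comment> \<open>takes at most half of the gain \<open>\<tau> \<delta>\<close> per time step\<close>
  define \<tau> where "\<tau> = min (1 / (2 * snr)) (\<delta> / (2 * V))"
  have \<tau>: "0 < \<tau>" "\<tau> * snr \<le> 1 / 2" "V * \<tau> \<le> \<delta> / 2"
  proof -
    show "0 < \<tau>" using snr_pos V \<delta> by (simp add: \<tau>_def)
    have "\<tau> * snr \<le> 1 / (2 * snr) * snr" using snr_pos by (intro mult_right_mono) (auto simp: \<tau>_def)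
    then show "\<tau> * snr \<le> 1 / 2" using snr_pos by simp
    have "V * \<tau> \<le> V * (\<delta> / (2 * V))" using V by (intro mult_left_mono) (auto simp: \<tau>_def)
    then show "V * \<tau> \<le> \<delta> / 2" using V by simp
  qed
  obtain N where N: "(1 - \<rho>) ^ N < \<eta> / 6"
    using real_arch_pow_inv[of "\<eta> / 6" "1 - \<rho>"] rho \<eta> by auto
  have "(1 - \<rho>) ^ (N + 1) \<le> (1 - \<rho>) ^ N" using rho by (intro power_decreasing) auto
  then have t1: "(1 - \<rho>) ^ (N + 1) \<le> \<eta> / 6" using N by linarith
  have "\<forall>\<^sub>F l in at_top. (real L + 2 * real L * real Rmax + \<tau> * \<delta> / 2)
      - (\<tau> * \<delta> / 2 * ((1 - \<eta> / 2) / ?D)) * l \<le> ln (\<eta> / 6)"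
    using \<eta> \<tau>(1) \<delta> total_rate_pos by (intro eventually_at_top_linear_le mult_pos_pos divide_pos_pos) auto
  moreover have gen: "k - p * (q * l / d - 1) = k + p - p * (q / d) * l" for k p q d l :: real
    by (simp add: algebra_simps)
  ultimately have ev2: "\<forall>\<^sub>F l in at_top. real L + 2 * real L * real Rmax
      - \<tau> * \<delta> / 2 * ((1 - \<eta> / 2) * l / ?D - 1) \<le> ln (\<eta> / 6)"
    by (simp only: gen)
  have ev1: "\<forall>\<^sub>F l in at_top. (real N + 1) * a - \<eta>\<^sup>2 / 4 * l \<le> ln (\<eta> / 6)"
    using \<eta> by (intro eventually_at_top_linear_le) auto
  have ev: "\<forall>\<^sub>F l in at_top. (real N + 1) * a - \<eta>\<^sup>2 / 4 * l \<le> ln (\<eta> / 6)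
      \<and> real L + 2 * real L * real Rmax - \<tau> * \<delta> / 2 * ((1 - \<eta> / 2) * l / ?D - 1) \<le> ln (\<eta> / 6)"
    by (rule eventually_conj[OF ev1 ev2])
  from eventually_neg_ln_at_right_0[OF ev] show ?thesis
  proof eventually_elim
    case (elim \<alpha>)
    define l where "l = - ln \<alpha>"
    have l: "0 < l" "\<alpha> = exp (- l)" using elim by (auto simp: l_def)
    note ev = elim[folded l_def]
    define x where "x = (1 - \<eta> / 2) * l / ?D"
    define K where "K = nat \<lfloor>x\<rfloor>"
    have "0 \<le> x" using \<eta> l total_rate_pos by (simp add: x_def)
    then have K: "real K \<le> x" "x < real K + 1" by (auto simp: K_def)
    \<comment> \<open>\<open>\<delta>\<close> above the mean of the log-likelihood ratio per time step\<close>
    define c where "c = (real L * kl_rate + \<delta>) * real K"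
    have t2: "exp c * \<alpha> / (1 - \<rho>) ^ (N + K + 1) \<le> \<eta> / 6"
    proof -
      have "exp c * \<alpha> / (1 - \<rho>) ^ (N + K + 1) = exp (c - l + real (N + K + 1) * a)"
        unfolding one_minus_rho_power l(2) a_def by (simp add: exp_add exp_diff exp_minus field_simps)
      also have "c - l + real (N + K + 1) * a = (?D + \<delta>) * real K - l + (real N + 1) * a"
        by (simp add: c_def a(2) algebra_simps)
      also have "\<dots> \<le> (?D + \<delta>) * x - l + (real N + 1) * a"
        using K(1) total_rate_pos \<delta> by (intro add_right_mono diff_right_mono mult_left_mono) auto
      also have "(?D + \<delta>) * x = (1 + \<eta> / 2) * (1 - \<eta> / 2) * l"
        using total_rate_pos by (simp add: \<delta>_def x_def field_simps)
      also have "(1 + \<eta> / 2) * (1 - \<eta> / 2) * l - l + (real N + 1) * a = (real N + 1) * a - \<eta>\<^sup>2 / 4 * l"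
        by (simp add: power2_eq_square algebra_simps)
      also have "exp \<dots> \<le> exp (ln (\<eta> / 6))" using ev by simp
      finally show ?thesis using \<eta> by simp
    qed
    have t3: "exp (- \<tau> * c + real L * (real (K + 1) * tilt_bound \<tau>) + 2 * real L * real Rmax) \<le> \<eta> / 6"
    proof -
      have "real L * tilt_bound \<tau> \<le> real L * 1"
        using abs_tilt_bound_le_1[of \<tau>] \<tau> by (intro mult_left_mono) auto
      moreover have "V * \<tau> * (\<tau> * real K) \<le> \<delta> / 2 * (\<tau> * real K)"
        using \<tau> by (intro mult_right_mono) auto
      moreover have "- \<tau> * c + real L * (real (K + 1) * tilt_bound \<tau>)
          = - \<tau> * \<delta> * real K + V * \<tau> * (\<tau> * real K) + real L * tilt_bound \<tau>"
        by (simp add: c_def V_def tilt_bound_def power2_eq_square algebra_simps)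
      ultimately have "- \<tau> * c + real L * (real (K + 1) * tilt_bound \<tau>) + 2 * real L * real Rmax
          \<le> real L + 2 * real L * real Rmax - \<tau> * \<delta> / 2 * real K"
        by (simp add: algebra_simps)
      also have "\<dots> \<le> real L + 2 * real L * real Rmax - \<tau> * \<delta> / 2 * (x - 1)"
        using K(2) \<tau> \<delta> by (intro diff_left_mono mult_left_mono) auto
      also have "\<dots> \<le> ln (\<eta> / 6)" using ev unfolding x_def by simp
      finally have "exp (- \<tau> * c + real L * (real (K + 1) * tilt_bound \<tau>) + 2 * real L * real Rmax)
          \<le> exp (ln (\<eta> / 6))" by simp
      then show ?thesis using \<eta> by simp
    qed
    show ?case
    proof (intro allI impI)
      fix T assume T: "stopping_time (info M X Y L) T" "PFA M t T \<le> \<alpha>"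
      have "(1 - \<eta>) * (l / ?D) \<le> (1 - \<eta> / 2) * (1 - \<eta> / 2) * (l / ?D)"
        using l total_rate_pos by (intro mult_right_mono) (auto simp: field_simps)
      also have "\<dots> = x * (1 - \<eta> / 2)" by (simp add: x_def)
      also have "\<dots> \<le> real (K + 1) * (1 - ((1 - \<rho>) ^ (N + 1) + exp c * \<alpha> / (1 - \<rho>) ^ (N + K + 1)
          + exp (- \<tau> * c + real L * (real (K + 1) * tilt_bound \<tau>) + 2 * real L * real Rmax)))"
        using K(2) t1 t2 t3 \<eta> by (intro mult_mono) auto
      finally show "ennreal ((1 - \<eta>) * (- ln \<alpha> / ?D)) \<le> ADD M t T"
        unfolding l_def[symmetric]
        using ADD_ge[OF T, of \<tau> K N c] \<tau> by (meson ennreal_leI less_imp_le order_trans)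
    qed
  qed
qed

definition optimal_ADD :: "real \<Rightarrow> ennreal" where
  "optimal_ADD \<alpha> = (INF T \<in> {T. stopping_time (info M X Y L) T \<and> PFA M t T \<le> \<alpha>}. ADD M t T)"

lemma ADD_sandwich:
  assumes \<eta>: "0 < \<eta>" "\<eta> < 1"
  shows "\<forall>\<^sub>F \<alpha> in at_right 0. 0 < - ln \<alpha> / total_rate \<and>
    ennreal ((1 - \<eta>) * (- ln \<alpha> / total_rate)) \<le> optimal_ADD \<alpha> \<and>
    optimal_ADD \<alpha> \<le> ADD M t (T_post \<alpha>) \<and>
    ADD M t (T_post \<alpha>) \<le> ennreal ((1 + \<eta>) * (- ln \<alpha> / total_rate))"
  using ADD_asymptotic_lower[OF \<eta>] ADD_T_post_asymptotic_upper[OF \<eta>(1)]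
    eventually_neg_ln_at_right_0[OF eventually_gt_at_top[of 0]]
proof eventually_elim
  case (elim \<alpha>)
  have "ennreal ((1 - \<eta>) * (- ln \<alpha> / total_rate)) \<le> optimal_ADD \<alpha>"
    unfolding optimal_ADD_def using elim(1) by (intro INF_greatest) simp
  moreover have "optimal_ADD \<alpha> \<le> ADD M t (T_post \<alpha>)"
    unfolding optimal_ADD_def
    using elim(3) by (intro INF_lower) (simp add: stopping_time_T_post PFA_T_post_le)
  moreover have "0 < - ln \<alpha> / total_rate" using elim(3) total_rate_pos by (intro divide_pos_pos) auto
  ultimately show ?case using elim(2) by (intro conjI)
qed

lemma ADD_sandwich_real:
  assumes \<eta>: "0 < \<eta>" "\<eta> < 1"
  shows "\<forall>\<^sub>F \<alpha> in at_right 0. \<exists>a b. optimal_ADD \<alpha> = ennreal a \<and> ADD M t (T_post \<alpha>) = ennreal b \<and>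
    0 < - ln \<alpha> / total_rate \<and> (1 - \<eta>) * (- ln \<alpha> / total_rate) \<le> a \<and> a \<le> b \<and> 0 < b \<and>
    b \<le> (1 + \<eta>) * (- ln \<alpha> / total_rate)"
  using ADD_sandwich[OF \<eta>]
proof eventually_elim
  case (elim \<alpha>)
  define g where "g = - ln \<alpha> / total_rate"
  note e = elim[folded g_def]
  have pos: "0 < (1 - \<eta>) * g" "0 < (1 + \<eta>) * g" using e \<eta> by auto
  obtain b where b: "0 \<le> b" "ADD M t (T_post \<alpha>) = ennreal b" "b \<le> (1 + \<eta>) * g"
    using e pos(2) by (auto simp: le_ennreal_iff)
  obtain a where a: "optimal_ADD \<alpha> = ennreal a" "a \<le> b" "0 \<le> a"
    using e b by (auto simp: le_ennreal_iff)
  have "(1 - \<eta>) * g \<le> a" using e a pos by (simp add: ennreal_le_iff)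
  moreover from this have "0 < b" using pos(1) a(2) by linarith
  ultimately show ?case using a b e unfolding g_def[symmetric] by (intro exI[of _ a] exI[of _ b] conjI) simp_all
qed

lemma T_post_asymptotically_optimal:
  "((\<lambda>\<alpha>. optimal_ADD \<alpha> / ADD M t (T_post \<alpha>)) \<longlongrightarrow> 1) (at_right 0)"
proof -
  let ?f = "\<lambda>\<alpha>. enn2real (optimal_ADD \<alpha>) / enn2real (ADD M t (T_post \<alpha>))"
  have "(?f \<longlongrightarrow> 1) (at_right 0)"
  proof (rule tendsto_1_if_eventually_near)
    fix \<eta> :: real assume \<eta>: "0 < \<eta>" "\<eta> < 1"
    have "0 < \<eta> / 2" "\<eta> / 2 < 1" using \<eta> by auto
    from ADD_sandwich_real[OF this]
    show "\<forall>\<^sub>F \<alpha> in at_right 0. 1 - \<eta> \<le> ?f \<alpha> \<and> ?f \<alpha> \<le> 1 + \<eta>"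
    proof eventually_elim
      case (elim \<alpha>)
      define g where "g = - ln \<alpha> / total_rate"
      from elim[folded g_def] obtain a b where ab: "optimal_ADD \<alpha> = ennreal a" "ADD M t (T_post \<alpha>) = ennreal b"
        "0 < g" "(1 - \<eta> / 2) * g \<le> a" "a \<le> b" "0 < b" "b \<le> (1 + \<eta> / 2) * g"
        by blast
      have a0: "0 \<le> a"
      proof -
        have "0 \<le> (1 - \<eta> / 2) * g" using ab(3) \<eta> by (intro mult_nonneg_nonneg) auto
        then show ?thesis using ab(4) by linarith
      qed
      have f: "?f \<alpha> = a / b" using ab(1,2,6) a0 by simp
      have "(1 - \<eta>) * b \<le> (1 - \<eta>) * ((1 + \<eta> / 2) * g)"
        using ab(7) \<eta> by (intro mult_left_mono) auto
      also have "\<dots> = ((1 - \<eta>) * (1 + \<eta> / 2)) * g" by simp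
      also have "\<dots> \<le> (1 - \<eta> / 2) * g"
        using ab(3) \<eta> by (intro mult_right_mono) (auto simp: algebra_simps)
      also note ab(4)
      finally have "1 - \<eta> \<le> a / b" using ab(6) by (simp add: pos_le_divide_eq)
      moreover have "a / b \<le> 1 + \<eta>"
        using ab(5,6) \<eta> by (simp add: pos_divide_le_eq algebra_simps add_increasing2)
      ultimately show ?case unfolding f ..
    qed
  qed
  then have lim: "((\<lambda>\<alpha>. ennreal (?f \<alpha>)) \<longlongrightarrow> ennreal 1) (at_right 0)"
    by (rule tendsto_ennrealI)
  have "\<forall>\<^sub>F \<alpha> in at_right 0. ennreal (?f \<alpha>) = optimal_ADD \<alpha> / ADD M t (T_post \<alpha>)"
    using ADD_sandwich_real[of "1 / 2", simplified]
  proof eventually_elim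
    case (elim \<alpha>)
    then obtain a b where ab: "optimal_ADD \<alpha> = ennreal a" "ADD M t (T_post \<alpha>) = ennreal b" "0 < b"
      "0 < - (ln \<alpha> / total_rate)" "- (ln \<alpha> / total_rate) / 2 \<le> a" by auto
    have "0 \<le> - (ln \<alpha> / total_rate) / 2" using ab(4) by (intro divide_nonneg_pos less_imp_le) simp_all
    then have "0 \<le> a" using ab(5) by (rule order_trans)
    then show ?case using ab by (simp add: divide_ennreal)
  qed
  then show ?thesis using Lim_transform_eventually[OF lim] by simp
qed

lemma ADD_T_post_first_order:
  "\<exists>\<epsilon> :: real \<Rightarrow> real. (\<epsilon> \<longlongrightarrow> 0) (at_right 0) \<and>
    (\<forall>\<^sub>F \<alpha> in at_right 0. ADD M t (T_post \<alpha>) = ennreal (\<bar>ln \<alpha>\<bar> / total_rate * (1 + \<epsilon> \<alpha>)))"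
proof (intro exI conjI)
  let ?f = "\<lambda>\<alpha>. enn2real (ADD M t (T_post \<alpha>)) / (- ln \<alpha> / total_rate)"
  let ?\<epsilon> = "\<lambda>\<alpha>. ?f \<alpha> - 1"
  have "(?f \<longlongrightarrow> 1) (at_right 0)"
  proof (rule tendsto_1_if_eventually_near)
    fix \<eta> :: real assume \<eta>: "0 < \<eta>" "\<eta> < 1"
    show "\<forall>\<^sub>F \<alpha> in at_right 0. 1 - \<eta> \<le> ?f \<alpha> \<and> ?f \<alpha> \<le> 1 + \<eta>"
      using ADD_sandwich_real[OF \<eta>]
    proof eventually_elim
      case (elim \<alpha>)
      define g where "g = - ln \<alpha> / total_rate"
      from elim[folded g_def] obtain a b where ab: "ADD M t (T_post \<alpha>) = ennreal b"
        "0 < g" "(1 - \<eta>) * g \<le> a" "a \<le> b" "0 < b" "b \<le> (1 + \<eta>) * g"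
        by blast
      then show ?case unfolding g_def[symmetric]
        by (simp add: pos_le_divide_eq pos_divide_le_eq)
    qed
  qed
  then show "(?\<epsilon> \<longlongrightarrow> 0) (at_right 0)" by (rule LIM_zero)
  show "\<forall>\<^sub>F \<alpha> in at_right 0. ADD M t (T_post \<alpha>) = ennreal (\<bar>ln \<alpha>\<bar> / total_rate * (1 + ?\<epsilon> \<alpha>))"
    using ADD_sandwich_real[of "1 / 2", simplified] eventually_neg_ln_at_right_0[OF eventually_gt_at_top[of 0]]
  proof eventually_elim
    case (elim \<alpha>)
    then obtain b where b: "ADD M t (T_post \<alpha>) = ennreal b" "0 < b" by blast
    have "\<bar>ln \<alpha>\<bar> = - ln \<alpha>" "ln \<alpha> \<noteq> 0" using elim(2) by auto
    then show ?case using b total_rate_pos by simp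
  qed
qed

end

theorem proposition5:
  fixes M :: "'a measure" and t :: "'a \<Rightarrow> nat"
    and X :: "nat \<Rightarrow> nat \<Rightarrow> 'a \<Rightarrow> real^2" and Y :: "nat \<Rightarrow> nat \<Rightarrow> 'a \<Rightarrow> real"
    and src :: "real^2" and R u :: real and Rmax L :: nat and \<rho> \<sigma> \<gamma> \<theta> :: real
  assumes "attenuating_signal_detection M t X Y src R u Rmax L \<rho> \<sigma> \<gamma> \<theta>"
  shows "((\<lambda>\<alpha>. (INF T \<in> {T. stopping_time (info M X Y L) T \<and> PFA M t T \<le> \<alpha>}. ADD M t T)
              / ADD M t (T_RP M t X Y L \<alpha>)) \<longlongrightarrow> 1) (at_right 0)
    \<and> (\<theta> = 2 \<longrightarrow>
        (\<exists>\<epsilon> :: real \<Rightarrow> real. (\<epsilon> \<longlongrightarrow> 0) (at_right 0) \<and>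
          (\<forall>\<^sub>F \<alpha> in at_right 0.
            ADD M t (T_RP M t X Y L \<alpha>) =
              ennreal (\<bar>ln \<alpha>\<bar> / (real L * q_free_space R (\<gamma>\<^sup>2 / \<sigma>\<^sup>2) + \<bar>ln (1 - \<rho>)\<bar>) * (1 + \<epsilon> \<alpha>)))))"
proof -
  interpret attenuating_signal_detection M t X Y src R u Rmax L \<rho> \<sigma> \<gamma> \<theta> by (rule assms)
  have rate: "total_rate = real L * q_free_space R (\<gamma>\<^sup>2 / \<sigma>\<^sup>2) + \<bar>ln (1 - \<rho>)\<bar>" if "\<theta> = 2"
    unfolding total_rate_def kl_rate_free_space[OF that] snr_def ..
  show ?thesis
  proof (intro conjI impI)
    show "((\<lambda>\<alpha>. (INF T \<in> {T. stopping_time (info M X Y L) T \<and> PFA M t T \<le> \<alpha>}. ADD M t T)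
        / ADD M t (T_RP M t X Y L \<alpha>)) \<longlongrightarrow> 1) (at_right 0)"
      by (rule T_post_asymptotically_optimal[unfolded optimal_ADD_def])
    show "\<exists>\<epsilon> :: real \<Rightarrow> real. (\<epsilon> \<longlongrightarrow> 0) (at_right 0) \<and> (\<forall>\<^sub>F \<alpha> in at_right 0. ADD M t (T_RP M t X Y L \<alpha>) =
        ennreal (\<bar>ln \<alpha>\<bar> / (real L * q_free_space R (\<gamma>\<^sup>2 / \<sigma>\<^sup>2) + \<bar>ln (1 - \<rho>)\<bar>) * (1 + \<epsilon> \<alpha>)))"
      if "\<theta> = 2"
      using ADD_T_post_first_order unfolding rate[OF that] .
  qed
qed

end
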